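(* Let $p$ be an odd prime. Then $$C^{\rm mixed}_{\rm sd}(p^2)=2\,C_{\rm su}(p)\,C_{\rm t}(p)$$ and $$C^{\rm mixed}_{\rm sd}(p^2)=D_{\rm sd}(p^2)-D_{\rm su}(p^2)-D_{\rm t}(p^2),$$ that is, the mixed self-complementary circulants of order $p^2$ are exactly the non-CI mixed self-complementary circulants of order $p^2$ (every mixed self-complementary circulant of order $p^2$ is non-CI).
   Context: All graphs are simple (no loops, no multiple edges or arcs). An undirected edge is identified with the pair of oppositely directed arcs, so undirected graphs are regarded as symmetric digraphs. A circulant of order $n$ is a digraph on the vertex set $\mathbb{Z}_n=\{0,1,\dots,n-1\}$ invariant under the cyclic permutation $v\mapsto v+1 \pmod n$ (equivalently, a Cayley digraph of $\mathbb{Z}_n$). A digraph is a tournament if for every two distinct vertices $u,v$ exactly one of the arcs $(u,v),(v,u)$ is present. The complement of a digraph has the same vertices and, for distinct $u,v$, the arc $(u,v)$ exactly when the original does not; a digraph is self-complementary if it is isomorphic to its complement. All enumerators count isomorphism classes: $C_{\rm sd}(n)$, $C_{\rm su}(n)$, $C_{\rm t}(n)$ are the numbers of self-complementary directed circulants (symmetric ones and tournaments included), self-complementary undirected circulants, and circulant tournaments of order $n$, respectively. A self-complementary directed circulant is mixed if it is neither an undirected graph nor a tournament, and $C^{\rm mixed}_{\rm sd}(n):=C_{\rm sd}(n)-C_{\rm su}(n)-C_{\rm t}(n)$. Two circulants of order $n$ are Cayley isomorphic if there is an isomorphism between them induced by an automorphism of the group $\mathbb{Z}_n$. A circulant is non-CI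 (non-Cayley isomorphic) if there exists a circulant isomorphic but not Cayley isomorphic to it. For ${\rm i}\in\{{\rm sd},{\rm su},{\rm t}\}$, $D_{\rm i}(n)$ denotes the number of isomorphism classes of non-CI circulants of order $n$ among those counted by $C_{\rm i}(n)$. *)

theory Defs
  imports
    "Graph_Theory.Graph_Theory"
    "HOL-Algebra.Elementary_Groups"
    "HOL-Computational_Algebra.Primes"
begin

text \<open>
  Digraphs without parallel arcs are the pair digraphs of the Graph Theory entry; the vertex
  set \<open>{0..<int n}\<close> is the carrier of \<open>integer_mod_group n\<close> whenever \<open>n > 0\<close>.
\<close>

definition circulant :: "nat \<Rightarrow> int pair_pre_digraph \<Rightarrow> bool" where
  "circulant n X \<longleftrightarrow> pair_digraph X \<and> pverts X = {0..<int n} \<and>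
     (let c = (\<lambda>v. (v + 1) mod int n) in map_prod c c ` parcs X = parcs X)"

definition isomorphic :: "'a pair_pre_digraph \<Rightarrow> 'b pair_pre_digraph \<Rightarrow> bool" where
  "isomorphic X Y \<longleftrightarrow> digraph_iso (with_proj X) (with_proj Y)"

definition undirected :: "'a pair_pre_digraph \<Rightarrow> bool" where
  "undirected X \<longleftrightarrow> symmetric (with_proj X)"

definition tournament :: "'a pair_pre_digraph \<Rightarrow> bool" where
  "tournament X \<longleftrightarrow> (\<forall>u \<in> pverts X. \<forall>v \<in> pverts X. u \<noteq> v \<longrightarrow>
     ((u, v) \<in> parcs X) \<noteq> ((v, u) \<in> parcs X))"

definition complement :: "'a pair_pre_digraph \<Rightarrow> 'a pair_pre_digraph" where
  "complement X = \<lparr>pverts = pverts X,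
     parcs = {(u, v). u \<in> pverts X \<and> v \<in> pverts X \<and> u \<noteq> v \<and> (u, v) \<notin> parcs X}\<rparr>"

definition self_complementary :: "'a pair_pre_digraph \<Rightarrow> bool" where
  "self_complementary X \<longleftrightarrow> isomorphic X (complement X)"

definition Cayley_isomorphic :: "nat \<Rightarrow> int pair_pre_digraph \<Rightarrow> int pair_pre_digraph \<Rightarrow> bool" where
  "Cayley_isomorphic n X Y \<longleftrightarrow>
     (\<exists>\<sigma> \<in> iso (integer_mod_group n) (integer_mod_group n).
        pverts Y = \<sigma> ` pverts X \<and> parcs Y = map_prod \<sigma> \<sigma> ` parcs X)"

definition non_CI :: "nat \<Rightarrow> int pair_pre_digraph \<Rightarrow> bool" where
  "non_CI n X \<longleftrightarrow> circulant n X \<and>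
     (\<exists>Y. circulant n Y \<and> isomorphic X Y \<and> \<not> Cayley_isomorphic n X Y)"

definition sd_circulants :: "nat \<Rightarrow> int pair_pre_digraph set" where
  "sd_circulants n = {X. circulant n X \<and> self_complementary X}"

definition su_circulants :: "nat \<Rightarrow> int pair_pre_digraph set" where
  "su_circulants n = {X. circulant n X \<and> self_complementary X \<and> undirected X}"

definition t_circulants :: "nat \<Rightarrow> int pair_pre_digraph set" where
  "t_circulants n = {X. circulant n X \<and> tournament X}"

definition mixed_sd_circulants :: "nat \<Rightarrow> int pair_pre_digraph set" where
  "mixed_sd_circulants n = {X \<in> sd_circulants n. \<not> undirected X \<and> \<not> tournament X}"

definition num_iso_classes :: "'a pair_pre_digraph set \<Rightarrow> nat" where
  "num_iso_classes A = card (A // {(X, Y). X \<in> A \<and> Y \<in> A \<and> isomorphic X Y})"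

definition C_sd :: "nat \<Rightarrow> nat" where
  "C_sd n = num_iso_classes (sd_circulants n)"

definition C_su :: "nat \<Rightarrow> nat" where
  "C_su n = num_iso_classes (su_circulants n)"

definition C_t :: "nat \<Rightarrow> nat" where
  "C_t n = num_iso_classes (t_circulants n)"

definition D_sd :: "nat \<Rightarrow> nat" where
  "D_sd n = num_iso_classes {X \<in> sd_circulants n. non_CI n X}"

definition D_su :: "nat \<Rightarrow> nat" where
  "D_su n = num_iso_classes {X \<in> su_circulants n. non_CI n X}"

definition D_t :: "nat \<Rightarrow> nat" where
  "D_t n = num_iso_classes {X \<in> t_circulants n. non_CI n X}"

definition C_sd_mixed :: "nat \<Rightarrow> int" where
  "C_sd_mixed n = int (C_sd n) - int (C_su n) - int (C_t n)"

end

theory Submission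
  imports Defs "HOL-Number_Theory.Residues" "HOL-Computational_Algebra.Polynomial"
begin

text \<open>
The proof is spectral. A circulant of order \<open>n\<close> with connection set \<open>S\<close> has the eigenvalues
\<open>\<lambda>\<^sub>j(S) = (\<Sum>s\<in>S. \<zeta>\<^sup>j\<^sup>s)\<close>, where \<open>\<zeta>\<close> is a primitive \<open>n\<close>-th root of unity, and isomorphic
circulants have the same eigenvalues with the same multiplicities, since the numbers of closed
walks agree (\<open>isomorphic_circ_spectrum\<close>). For \<open>n\<close> a power of \<open>p\<close>, an equation between eigenvalues can
be read off again in terms of the sets: an integer combination of the powers of \<open>\<zeta>\<close> vanishes
only if its coefficients are constant on the cosets of the subgroup of order \<open>p\<close>
(\<open>vanishing_sum_of_unity\<close>, by Eisenstein's criterion).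

Let \<open>S\<close> be the connection set of a self-complementary circulant of order \<open>p\<^sup>2\<close>. Each
\<open>\<lambda>\<^sub>i(S)\<close> with \<open>i \<noteq> 0\<close> has a partner with \<open>\<lambda>\<^sub>i(S) + \<lambda>\<^sub>j(S) = -1\<close>. Suppose that some coset of
\<open>p\<int>\<close> other than \<open>p\<int>\<close> itself meets \<open>S\<close> in a proper nonempty part. Then the partner of \<open>\<lambda>\<^sub>1\<close> yields
a multiplier \<open>\<mu>\<close> that exchanges \<open>S\<close> and its complement on these partial cosets and among the
nonzero elements of \<open>p\<int>\<close>, and the partner of \<open>\<lambda>\<^sub>p\<close> yields a multiplier \<open>\<nu>\<close> that exchanges the coset sizes \<open>a\<close> and \<open>p - a\<close>.
Some power of such a multiplier is \<open>-1\<close> (\<open>power_eq_minus_one_prime_power\<close>), so that on both parts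
negation either preserves or complements \<open>S\<close>; as \<open>p\<close> is odd, a partial coset does
not allow different answers. Hence the circulant is undirected or a tournament
(\<open>self_complementary_sign_if_not_coset_closed\<close>).

A mixed circulant is therefore a wreath product of two circulants of order \<open>p\<close>. Comparing spectra
once more shows that the two factors are determined up to multipliers
(\<open>isomorphic_wreath_imp_mult_equiv\<close>); in particular both are self-complementary by a multiplier,
so each is undirected or a tournament, and the product is mixed exactly if one factor is of
each kind. The two orders of the factors give \<open>2 C_su(p) C_t(p)\<close> classes.

That a mixed circulant \<open>X\<close> is non-CI has the complement of \<open>X\<close> as witness: if a multiplier mapped
\<open>X\<close> to its complement, then a power of it equal to \<open>-1\<close> would make \<open>X\<close> undirected or a tournament.
\<close>

section \<open>Integer relations between roots of unity of prime power order\<close>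

text \<open>
Eisenstein's criterion in the form of irreducibility over the rationals, with denominators
cleared by the factor \<open>c\<close>. Factors \<open>p\<close> of \<open>c\<close> can be cancelled because \<open>p\<close> is prime in the
polynomial ring; afterwards one of the constant coefficients of \<open>A\<close> and \<open>Q\<close> is prime to \<open>p\<close>,
and in the other factor no coefficient below the degree of \<open>F\<close> is, which leaves
degree \<open>0\<close> for the former.
\<close>

lemma eisenstein_int:
  fixes F A Q :: "int poly" and p :: nat
  assumes p: "prime p"
    and lead: "\<not> int p dvd coeff F (degree F)"
    and low: "\<And>i. i < degree F \<Longrightarrow> int p dvd coeff F i"
    and c0: "\<not> int p ^ 2 dvd coeff F 0"
    and "c \<noteq> 0" and "smult c F = A * Q"
  shows "degree A = 0 \<or> degree Q = 0"
  using assms(5,6)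
proof (induction "nat \<bar>c\<bar>" arbitrary: c A Q rule: less_induct)
  case less
  have pp: "prime_elem (int p)" using p by simp
  have p1: "int p > 1" using p prime_gt_1_nat by simp
  have cancel: "X = Y" if "smult (int p) X = smult (int p) Y" for X Y
  proof -
    have "coeff X i = coeff Y i" for i
      using arg_cong[OF that, of "\<lambda>f. coeff f i"] p1 by simp
    then show ?thesis by (simp add: poly_eq_iff)
  qed
  show ?case
  proof (cases "int p dvd c")
    case True
    then obtain d where d: "c = int p * d" by auto
    have "[:int p:] dvd A * Q"
      unfolding less.prems(2)[symmetric] const_poly_dvd_iff using d by simp
    then have "[:int p:] dvd A \<or> [:int p:] dvd Q"
      using pp prime_elem_const_poly_iff prime_elem_dvd_mult_iff by blast
    moreover have lt: "nat \<bar>d\<bar> < nat \<bar>c\<bar>" "d \<noteq> 0"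
      using d less.prems(1) p1 by (auto simp: abs_mult)
    ultimately show ?thesis
    proof (elim disjE)
      assume "[:int p:] dvd A"
      then obtain B where B: "A = smult (int p) B" by (auto elim!: dvdE)
      have "smult (int p) (smult d F) = smult (int p) (B * Q)"
        using less.prems(2) d B by simp
      then have "smult d F = B * Q" by (rule cancel)
      from less.hyps[OF lt this] B p1 show ?thesis by auto
    next
      assume "[:int p:] dvd Q"
      then obtain B where B: "Q = smult (int p) B" by (auto elim!: dvdE)
      have "smult (int p) (smult d F) = smult (int p) (A * B)"
        using less.prems(2) d B by simp
      then have "smult d F = A * B" by (rule cancel)
      from less.hyps[OF lt this] B p1 show ?thesis by auto
    qed
  next
    case pc: False
    have nz: "A \<noteq> 0" "Q \<noteq> 0" "F \<noteq> 0"
      using less.prems lead by auto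
    have deg: "degree F = degree A + degree Q"
      using less.prems degree_mult_eq[OF nz(1,2)] by (metis degree_smult_eq)
    have one_side: "degree B = 0" if fac: "smult c F = B * C" and nB: "\<not> int p dvd coeff B 0"
        and dC: "degree F = degree B + degree C" for B C :: "int poly"
    proof -
      have "\<not> int p dvd c * coeff F (degree F)"
        using pc lead pp by (simp add: prime_elem_dvd_mult_iff)
      then have "\<not> [:int p:] dvd smult c F"
        unfolding const_poly_dvd_iff by (metis coeff_smult)
      then have "\<not> [:int p:] dvd C" unfolding fac by auto
      then obtain i where "\<not> int p dvd coeff C i" unfolding const_poly_dvd_iff by auto
      define j where "j = (LEAST i. \<not> int p dvd coeff C i)"
      have j: "\<not> int p dvd coeff C j" unfolding j_def by (rule LeastI) fact
      have jl: "int p dvd coeff C i" if "i < j" for i using that not_less_Least j_def by blast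
      have "coeff (B * C) j = (\<Sum>i\<le>j. coeff B i * coeff C (j - i))" by (rule coeff_mult)
      also have "\<dots> = coeff B 0 * coeff C j + (\<Sum>i\<in>{..j}-{0}. coeff B i * coeff C (j - i))"
        by (subst sum.remove[of _ 0]) auto
      finally have e: "coeff (B * C) j = coeff B 0 * coeff C j + (\<Sum>i\<in>{..j}-{0}. coeff B i * coeff C (j - i))" .
      have "int p dvd (\<Sum>i\<in>{..j}-{0}. coeff B i * coeff C (j - i))"
        by (intro dvd_sum dvd_mult jl) auto
      moreover have "\<not> int p dvd coeff B 0 * coeff C j"
        using nB j pp by (simp add: prime_elem_dvd_mult_iff)
      ultimately have "\<not> int p dvd coeff (B * C) j" unfolding e by (simp add: dvd_add_left_iff)
      then have "\<not> int p dvd coeff F j" unfolding fac[symmetric] by auto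
      then have "degree F \<le> j" using low not_le by blast
      moreover have "j \<le> degree C" by (rule le_degree) (use j in auto)
      ultimately show ?thesis using dC by simp
    qed
    have "\<not> (int p dvd coeff A 0 \<and> int p dvd coeff Q 0)"
    proof
      assume "int p dvd coeff A 0 \<and> int p dvd coeff Q 0"
      then have "int p * int p dvd coeff A 0 * coeff Q 0" by (auto intro: mult_dvd_mono)
      also have "\<dots> = coeff (A * Q) 0" by (simp add: coeff_mult)
      also have "\<dots> = c * coeff F 0" using less.prems(2)[symmetric] by simp
      finally have "int p ^ 2 dvd c * coeff F 0" by (simp add: power2_eq_square)
      moreover have "coprime (int p ^ 2) c"
        using pc pp p by (simp add: prime_imp_coprime)
      ultimately show False using c0 coprime_dvd_mult_right_iff by blast
    qed
    then show ?thesis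
      using one_side[of A Q] one_side[of Q A] less.prems(2) deg by (auto simp: mult.commute)
  qed
qed

abbreviation ipoly :: "int poly \<Rightarrow> complex \<Rightarrow> complex" where
  "ipoly f \<equiv> poly (map_poly of_int f)"

lemma ipoly_simps [simp]:
  "ipoly 0 z = 0" "ipoly (f + g) z = ipoly f z + ipoly g z" "ipoly (f * g) z = ipoly f z * ipoly g z"
  "ipoly (pCons a f) z = of_int a + z * ipoly f z" "ipoly (smult a f) z = of_int a * ipoly f z"
proof -
  show add: "ipoly (f + g) z = ipoly f z + ipoly g z" for f g
    by (subst poly_add[symmetric], rule arg_cong[of _ _ "\<lambda>f. poly f z"])
       (simp add: poly_eq_iff coeff_map_poly)
  show pc: "ipoly (pCons a f) z = of_int a + z * ipoly f z" for a f
    by (simp add: map_poly_pCons)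
  show sm: "ipoly (smult a f) z = of_int a * ipoly f z" for a f
    by (induction f) (simp_all add: pc algebra_simps del: map_poly_pCons)
  show "ipoly (f * g) z = ipoly f z * ipoly g z"
    by (induction f) (simp_all add: pc add sm algebra_simps del: map_poly_pCons)
qed simp

lemma ipoly_monom [simp]: "ipoly (monom a n) z = of_int a * z ^ n"
  by (simp add: map_poly_monom poly_monom)

lemma ipoly_sum: "ipoly (sum f A) z = (\<Sum>i\<in>A. ipoly (f i) z)"
  by (induction A rule: infinite_finite_induct) auto

lemma ipoly_pcompose: "ipoly (f \<circ>\<^sub>p g) z = ipoly f (ipoly g z)"
  by (induction f) (simp_all add: pcompose_pCons)

text \<open>
A nonzero polynomial of least degree with root \<open>z\<close> divides \<open>F\<close> up to a constant, by
pseudo-division.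
\<close>

lemma degree_root_ge_eisenstein:
  fixes F b :: "int poly" and p :: nat and z :: complex
  assumes p: "prime p"
    and lead: "\<not> int p dvd coeff F (degree F)"
    and low: "\<And>i. i < degree F \<Longrightarrow> int p dvd coeff F i"
    and c0: "\<not> int p ^ 2 dvd coeff F 0"
    and F: "ipoly F z = 0" and b: "ipoly b z = 0" "degree b < degree F"
  shows "b = 0"
  using b
proof (induction "degree b" arbitrary: b rule: less_induct)
  case less
  show ?case
  proof (rule ccontr)
    assume b0: "b \<noteq> 0"
    obtain q r where qr: "pseudo_divmod F b = (q, r)" by force
    define c where "c = coeff b (degree b) ^ (Suc (degree F) - degree b)"
    have c: "c \<noteq> 0" using b0 by (simp add: c_def)
    have eq: "smult c F = b * q + r" and r: "r = 0 \<or> degree r < degree b"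
      using pseudo_divmod[OF b0 qr] c_def by auto
    have "ipoly (smult c F) z = ipoly (b * q + r) z" using eq by simp
    then have "ipoly r z = 0" using F less.prems by simp
    then have "r = 0" using r less.hyps less.prems by fastforce
    then have eq: "smult c F = b * q" using eq by simp
    have "degree b = 0 \<or> degree q = 0"
      using eisenstein_int[OF p lead low c0 c eq] by simp
    then show False
    proof
      assume "degree b = 0"
      then obtain a where "b = [:a:]" by (rule degree_eq_zeroE)
      then show False using b0 less.prems by simp
    next
      assume "degree q = 0"
      moreover have "q \<noteq> 0" using eq c less.prems by auto
      ultimately have "degree F = degree b"
        using eq c b0 by (metis add.right_neutral degree_mult_eq degree_smult_eq)
      then show False using less.prems by simp
    qed
  qed
qed

text \<open>
The \<open>p\<close>-power map is additive modulo \<open>p\<close>.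
\<close>

lemma frobenius_int_poly:
  fixes p :: nat
  assumes p: "prime p"
  shows "\<exists>R. ([:1, 1:] :: int poly) ^ (p ^ k) = monom 1 (p ^ k) + 1 + [:int p:] * R"
proof (induction k)
  case 0
  show ?case by (rule exI[of _ 0]) (simp add: monom_altdef one_pCons)
next
  case (Suc k)
  define V :: "int poly" where "V = monom 1 (p ^ k)"
  obtain R where R: "([:1, 1:] :: int poly) ^ (p ^ k) = V + 1 + [:int p:] * R"
    using Suc V_def by auto
  have "(V + 1) ^ p = (\<Sum>i\<le>p. of_nat (p choose i) * V ^ i)"
    by (simp add: binomial_ring)
  also have "\<dots> = V ^ p + 1 + (\<Sum>i\<in>{..p}-{0,p}. of_nat (p choose i) * V ^ i)"
    using prime_gt_0_nat[OF p]
    by (subst sum.remove[of _ 0], simp, simp, subst sum.remove[of _ p])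
       (auto simp: Diff_insert2[symmetric] insert_commute)
  finally have bin: "(V + 1) ^ p = V ^ p + 1 + (\<Sum>i\<in>{..p}-{0,p}. of_nat (p choose i) * V ^ i)" .
  have pdvd: "[:int p:] dvd of_nat m" if "p dvd m" for m
  proof -
    have "(of_nat m :: int poly) = [:int m:]" by (simp add: of_nat_poly)
    then show ?thesis using that by (simp add: int_dvd_int_iff)
  qed
  have "[:int p:] dvd (\<Sum>i\<in>{..p}-{0,p}. of_nat (p choose i) * V ^ i)"
    by (intro dvd_sum dvd_mult2 pdvd dvd_choose_prime[OF _ _ _ p]) (use p in auto)
  then obtain R1 where R1: "(V + 1) ^ p = V ^ p + 1 + [:int p:] * R1"
    using bin by (auto elim!: dvdE)
  define R2 where "R2 = R * (\<Sum>i<p. (V + 1) ^ (p - Suc i) * (V + 1 + [:int p:] * R) ^ i)"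
  have R2: "(V + 1 + [:int p:] * R) ^ p - (V + 1) ^ p = [:int p:] * R2"
    unfolding R2_def power_diff_sumr2 by (simp only: add_diff_cancel_left' mult.assoc)
  have "(V + 1 + [:int p:] * R) ^ p = (V + 1) ^ p + [:int p:] * R2"
    unfolding R2[symmetric] by (simp only: add_diff_cancel_left' add_diff_eq)
  also have "\<dots> = V ^ p + 1 + [:int p:] * (R1 + R2)"
    unfolding R1 distrib_left by (simp only: add.assoc)
  finally have "(V + 1 + [:int p:] * R) ^ p = V ^ p + 1 + [:int p:] * (R1 + R2)" .
  moreover have "([:1, 1:] :: int poly) ^ (p ^ Suc k) = (V + 1 + [:int p:] * R) ^ p"
    unfolding R[symmetric] by (simp add: power_mult[symmetric] mult.commute)
  moreover have "V ^ p = monom 1 (p ^ Suc k)"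
    by (simp add: V_def monom_power mult.commute)
  ultimately show ?case by metis
qed

text \<open>
For \<open>q\<close> a power of the prime \<open>p\<close> this is the cyclotomic polynomial of order \<open>p * q\<close>.
\<close>

definition prime_power_cyclotomic :: "nat \<Rightarrow> nat \<Rightarrow> int poly" where
  "prime_power_cyclotomic p q = (\<Sum>i<p. monom 1 (i * q))"

text \<open>
Substituting \<open>x + 1\<close> for \<open>x\<close> turns the cyclotomic polynomial into one to which Eisenstein's criterion
applies: it is the quotient of \<open>(x + 1)\<^sup>p\<^sup>q - 1\<close> and \<open>(x + 1)\<^sup>q - 1\<close>, so modulo \<open>p\<close> it is a power of \<open>x\<close>.
\<close>

lemma degree_root_ge_cyclotomic:
  fixes p k :: nat and z :: complex
  assumes p: "prime p" and z: "ipoly (prime_power_cyclotomic p (p ^ k)) z = 0"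
    and b: "ipoly b z = 0" "degree b < (p - 1) * p ^ k"
  shows "b = 0"
proof -
  define q where "q = p ^ k"
  define P where "P = prime_power_cyclotomic p q"
  define F where "F = P \<circ>\<^sub>p [:1, 1:]"
  have p0: "p > 1" "q > 0" using p prime_gt_1_nat by (auto simp: q_def prime_gt_0_nat)
  have cP: "coeff P i = (if i \<in> (\<lambda>i. i * q) ` {..<p} then 1 else 0)" for i
  proof -
    have "coeff P i = (\<Sum>j<p. if j * q = i then 1 else 0)"
      unfolding P_def prime_power_cyclotomic_def coeff_sum coeff_monom by simp
    also have "\<dots> = (\<Sum>j\<in>{j\<in>{..<p}. j * q = i}. 1)" by (rule sum.inter_filter[symmetric]) simp
    also have "\<dots> = (if i \<in> (\<lambda>i. i * q) ` {..<p} then 1 else 0)"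
    proof (cases "i \<in> (\<lambda>i. i * q) ` {..<p}")
      case True
      then obtain j where "j < p" "i = j * q" by auto
      then have "{j\<in>{..<p}. j * q = i} = {j}" using p0 by auto
      then show ?thesis using True by simp
    next
      case False
      then have "{j\<in>{..<p}. j * q = i} = {}" by auto
      then show ?thesis using False by simp
    qed
    finally show ?thesis .
  qed
  have dP: "degree P = (p - 1) * q"
  proof (rule antisym)
    show "degree P \<le> (p - 1) * q"
      by (rule degree_le) (use p0 in \<open>auto simp: cP\<close>)
    show "(p - 1) * q \<le> degree P"
      by (rule le_degree) (use p0 in \<open>auto simp: cP\<close>)
  qed
  have dF: "degree F = (p - 1) * q" by (simp add: F_def dP degree_pcompose)
  have "P * (monom 1 q - 1) = monom 1 (p * q) - 1"
  proof -
    have "P = (\<Sum>i<p. monom 1 q ^ i)"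
      by (simp add: P_def prime_power_cyclotomic_def monom_power mult.commute)
    then have "(monom 1 q - 1) * P = monom 1 q ^ p - 1"
      by (simp add: power_diff_1_eq)
    then show ?thesis by (simp add: monom_power mult.commute)
  qed
  then have comp: "(P * (monom 1 q - 1)) \<circ>\<^sub>p [:1, 1:] = (monom 1 (p * q) - 1) \<circ>\<^sub>p [:1, 1:]" by simp
  have pcpow: "(f ^ m) \<circ>\<^sub>p [:1, 1:] = (f \<circ>\<^sub>p [:1, 1:]) ^ m" for f :: "int poly" and m
    by (induction m) (simp_all add: pcompose_mult pcompose_1)
  from comp have FX: "F * ([:1, 1:] ^ q - 1) = [:1, 1:] ^ (p * q) - 1"
    by (simp add: F_def pcompose_mult pcompose_diff pcompose_1 monom_altdef pcompose_smult pcpow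
        pcompose_pCons)
  obtain R where R: "([:1, 1:] :: int poly) ^ q = monom 1 q + 1 + [:int p:] * R"
    using frobenius_int_poly[OF p] q_def by auto
  obtain R' where R': "([:1, 1:] :: int poly) ^ (p * q) = monom 1 (p * q) + 1 + [:int p:] * R'"
    using frobenius_int_poly[OF p, of "Suc k"] q_def by auto
  have "F * monom 1 q = monom 1 (p * q) + [:int p:] * (R' - F * R)"
    using FX R R' by (simp add: algebra_simps)
  then have "coeff (F * monom 1 q) (i + q) = coeff (monom 1 (p * q) + [:int p:] * (R' - F * R)) (i + q)" for i
    by simp
  then have cF: "coeff F i = (if p * q = i + q then 1 else 0) + int p * coeff (R' - F * R) (i + q)" for i
    by (simp add: coeff_monom mult.commute[of F] coeff_monom_mult)
  have pq: "p * q = (p - 1) * q + q" using p0 by (simp add: algebra_simps)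
  have "poly P 1 = int p" by (simp add: P_def prime_power_cyclotomic_def poly_sum poly_monom)
  then have F0: "coeff F 0 = int p" by (simp add: F_def poly_0_coeff_0[symmetric] poly_pcompose)
  have eis: "\<not> int p dvd coeff F (degree F)" "\<And>i. i < degree F \<Longrightarrow> int p dvd coeff F i"
    "\<not> int p ^ 2 dvd coeff F 0"
  proof -
    show "\<not> int p dvd coeff F (degree F)"
      unfolding cF dF using pq p0 by (simp add: dvd_add_left_iff)
    show "int p dvd coeff F i" if "i < degree F" for i
      unfolding cF using that dF pq by simp
    show "\<not> int p ^ 2 dvd coeff F 0"
    proof
      assume "int p ^ 2 dvd coeff F 0"
      then have "int p * int p dvd int p * 1" unfolding F0 by (simp add: power2_eq_square)
      then have "int p dvd 1" using p0 by (subst (asm) dvd_mult_cancel_left) auto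
      then show False using p0 by simp
    qed
  qed
  have 1: "ipoly F (z - 1) = 0" "ipoly (b \<circ>\<^sub>p [:1, 1:]) (z - 1) = 0"
    using z b by (simp_all add: F_def ipoly_pcompose P_def q_def)
  have "degree (b \<circ>\<^sub>p [:1, 1:]) < degree F"
    unfolding dF using b(2) by (simp add: degree_pcompose q_def)
  then have "b \<circ>\<^sub>p [:1, 1:] = 0"
    using degree_root_ge_eisenstein[OF p eis 1] by simp
  then show ?thesis by (simp add: pcompose_eq_0)
qed

definition unity :: "nat \<Rightarrow> int \<Rightarrow> complex" where
  "unity n k = cis (2 * pi * of_int k / of_nat n)"

lemma unity_add: "unity n (a + b) = unity n a * unity n b"
  by (simp add: unity_def cis_mult add_divide_distrib distrib_left)

lemma unity_0 [simp]: "unity n 0 = 1"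
  by (simp add: unity_def)

lemma unity_power: "unity n a ^ m = unity n (a * int m)"
  by (simp add: unity_def DeMoivre algebra_simps)

lemma unity_eq_1_iff:
  assumes "n > 0"
  shows "unity n k = 1 \<longleftrightarrow> int n dvd k"
proof
  assume "int n dvd k"
  then obtain m where "k = int n * m" by auto
  then show "unity n k = 1" using assms cis_multiple_2pi[of "of_int m"] by (simp add: unity_def mult.assoc)
next
  assume "unity n k = 1"
  then have "cos (2 * pi * of_int k / of_nat n) = 1"
    by (simp add: unity_def complex_eq_iff)
  then obtain m :: int where "2 * pi * of_int k / of_nat n = of_int m * 2 * pi"
    using cos_one_2pi_int by auto
  then have "(of_int k :: real) = of_int (int n * m)" using assms by (simp add: field_simps)
  then show "int n dvd k" by (simp only: of_int_eq_iff dvd_triv_left)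
qed

lemma unity_cong:
  assumes "n > 0" "[a = b] (mod int n)"
  shows "unity n a = unity n b"
proof -
  have "unity n (a - b) = 1" using assms by (simp add: unity_eq_1_iff cong_iff_dvd_diff)
  then show ?thesis using unity_add[of n "a - b" b] by simp
qed

lemma unity_mod: "n > 0 \<Longrightarrow> unity n (a mod int n) = unity n a"
  by (rule unity_cong) (auto simp: cong_def)

lemma unity_mult_left: "m > 0 \<Longrightarrow> unity (m * n) (int m * k) = unity n k"
  by (simp add: unity_def mult.assoc)

lemma sum_powers_of_unity:
  assumes "n > 0"
  shows "(\<Sum>t<n. unity n (int t * k)) = (if int n dvd k then of_nat n else 0)"
proof (cases "int n dvd k")
  case True
  then have "unity n (int t * k) = 1" for t using assms by (simp add: unity_eq_1_iff)
  then show ?thesis using True by simp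
next
  case False
  have "(unity n k - 1) * (\<Sum>t<n. unity n k ^ t) = unity n k ^ n - 1" by (simp add: power_diff_1_eq)
  also have "\<dots> = 0" using assms by (simp add: unity_power unity_eq_1_iff)
  finally have "(\<Sum>t<n. unity n k ^ t) = 0" using False assms by (simp add: unity_eq_1_iff)
  then show ?thesis using False by (simp add: unity_power mult.commute)
qed

lemma sum_int_range: "(\<Sum>j\<in>{0..<int n}. f j) = (\<Sum>t<n. f (int t))"
  by (rule sum.reindex_bij_witness[of _ int nat]) auto

lemma sum_unity_range:
  assumes "n > 0"
  shows "(\<Sum>j\<in>{0..<int n}. unity n (j * k)) = (if int n dvd k then of_nat n else 0)"
  using sum_powers_of_unity[OF assms] by (simp add: sum_int_range)

text \<open>
Subtracting from every coefficient the coefficient of the same residue modulo \<open>p ^ k\<close> in the top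
block \<open>{(p - 1) * p ^ k..<p ^ Suc k}\<close> does not change the sum, since the powers of \<open>\<zeta>\<close> over a
residue class sum to zero. What remains is a polynomial of degree less than \<open>(p - 1) * p ^ k\<close>.
\<close>

lemma vanishing_sum_of_unity:
  fixes p k :: nat and a :: "int \<Rightarrow> int"
  assumes p: "prime p"
    and sum0: "(\<Sum>x\<in>{0..<int (p ^ Suc k)}. of_int (a x) * unity (p ^ Suc k) x) = 0"
    and x: "x \<in> {0..<int (p ^ Suc k)}" and y: "y \<in> {0..<int (p ^ Suc k)}"
    and xy: "[x = y] (mod int (p ^ k))"
  shows "a x = a y"
proof -
  define q n where "q = p ^ k" and "n = p ^ Suc k"
  have p0: "p > 1" "q > 0" "n > 0" using p prime_gt_1_nat by (auto simp: q_def n_def prime_gt_0_nat)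
  have n: "n = p * q" by (simp add: n_def q_def)
  have n': "n = (p - 1) * q + q" using p0 by (simp add: n algebra_simps)
  define z where "z = unity n 1"
  have zp: "z ^ i = unity n (int i)" for i by (simp add: z_def unity_power)
  have "(\<Sum>t<p. unity n (int (t * q))) = (\<Sum>t<p. unity p (int t * 1))"
    using p0 by (intro sum.cong) (simp_all add: n flip: unity_mult_left[of q p], simp add: mult.commute)
  also have "\<dots> = 0" using p0 sum_powers_of_unity[of p 1] by simp
  finally have z0: "(\<Sum>t<p. z ^ (t * q)) = 0" by (simp add: zp)
  have cyc: "ipoly (prime_power_cyclotomic p (p ^ k)) z = 0"
    using z0 by (simp add: prime_power_cyclotomic_def ipoly_sum q_def)
  define c where "c r = a (int ((p - 1) * q + r))" for r
  define d where "d i = a (int i) - c (i mod q)" for i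
  define b where "b = (\<Sum>i<(p - 1) * q. monom (d i) i)"
  have top: "d i = 0" if "(p - 1) * q \<le> i" "i < n" for i
  proof -
    have "i = (p - 1) * q + (i - (p - 1) * q)" "i - (p - 1) * q < q" using that n' by auto
    then have "i mod q = i - (p - 1) * q" by (metis mod_less mod_mult_self3)
    then show ?thesis using that by (simp add: d_def c_def)
  qed
  have per: "(\<Sum>i<n. of_int (c (i mod q)) * z ^ i) = 0"
  proof -
    have "(\<Sum>i<n. of_int (c (i mod q)) * z ^ i)
        = (\<Sum>t<p. \<Sum>i\<in>{t * q..<t * q + q}. of_int (c (i mod q)) * z ^ i)"
      unfolding n by (rule sum.nat_group[symmetric])
    also have "\<dots> = (\<Sum>t<p. \<Sum>r<q. of_int (c r) * z ^ r * z ^ (t * q))"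
    proof (rule sum.cong[OF refl])
      fix t
      show "(\<Sum>i\<in>{t * q..<t * q + q}. of_int (c (i mod q)) * z ^ i)
          = (\<Sum>r<q. of_int (c r) * z ^ r * z ^ (t * q))"
        by (rule sum.reindex_bij_witness[of _ "\<lambda>r. t * q + r" "\<lambda>i. i - t * q"])
           (auto simp: power_add mod_mult_self3 elim!: le_Suc_ex[elim_format])
    qed
    also have "\<dots> = (\<Sum>r<q. of_int (c r) * z ^ r * (\<Sum>t<p. z ^ (t * q)))"
      by (subst sum.swap) (simp add: sum_distrib_left)
    finally show ?thesis by (simp add: z0)
  qed
  have "ipoly b z = (\<Sum>i<(p - 1) * q. of_int (d i) * z ^ i)"
    by (simp add: b_def ipoly_sum)
  also have "\<dots> = (\<Sum>i<n. of_int (d i) * z ^ i)"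
    by (rule sum.mono_neutral_left) (use n' top in auto)
  also have "\<dots> = (\<Sum>i<n. of_int (a (int i)) * unity n (int i)) - (\<Sum>i<n. of_int (c (i mod q)) * z ^ i)"
    by (simp add: d_def algebra_simps sum_subtractf zp)
  also have "\<dots> = 0"
    using sum0 per unfolding n_def[symmetric] by (simp add: sum_int_range)
  finally have b0: "ipoly b z = 0" .
  have "b = 0"
  proof (cases "b = 0")
    case False
    have "degree b < (p - 1) * p ^ k"
    proof (rule degree_lessI)
      show "b \<noteq> 0 \<or> (p - 1) * p ^ k > 0" using False by simp
      show "\<forall>i\<ge>(p - 1) * p ^ k. coeff b i = 0"
        by (auto simp: b_def coeff_sum coeff_monom q_def)
    qed
    then show ?thesis using degree_root_ge_cyclotomic[OF p cyc b0] by simp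
  qed simp
  then have "coeff b i = 0" for i by simp
  moreover have "coeff b i = d i" if "i < (p - 1) * q" for i
    using that by (simp add: b_def coeff_sum coeff_monom)
  ultimately have d0: "d i = 0" if "i < n" for i
    using that top by (cases "i < (p - 1) * q") auto
  have "nat x mod q = nat y mod q"
  proof -
    have "int (nat x mod q) = int (nat y mod q)"
      using x y xy by (simp add: zmod_int cong_def q_def)
    then show ?thesis by simp
  qed
  moreover have "nat x < n" "nat y < n"
    using x y unfolding n_def[symmetric] by (simp_all add: nat_less_iff)
  then have "a x = c (nat x mod q)" "a y = c (nat y mod q)"
    using d0[of "nat x"] d0[of "nat y"] x y by (auto simp: d_def)
  ultimately show ?thesis by simp
qed

section \<open>Eigenvalues of circulants\<close>

definition eigenvalue_sum :: "nat \<Rightarrow> int set \<Rightarrow> int \<Rightarrow> complex" where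
  "eigenvalue_sum n S j = (\<Sum>s\<in>S. unity n (s * j))"

text \<open>
The coefficient of \<open>unity n x\<close> in \<open>eigenvalue_sum n S j\<close>. For \<open>j\<close> prime to \<open>n\<close> this is the
indicator function of the dilated set \<open>j * S\<close>.
\<close>

definition mult_count :: "nat \<Rightarrow> int set \<Rightarrow> int \<Rightarrow> int \<Rightarrow> nat" where
  "mult_count n S j x = card {s \<in> S. (s * j) mod int n = x}"

lemma eigenvalue_sum_conv_count:
  assumes "n > 0" "finite S"
  shows "eigenvalue_sum n S j = (\<Sum>x\<in>{0..<int n}. of_nat (mult_count n S j x) * unity n x)"
proof -
  have "eigenvalue_sum n S j = (\<Sum>s\<in>S. unity n ((s * j) mod int n))"
    using assms by (simp add: eigenvalue_sum_def unity_mod)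
  also have "\<dots> = (\<Sum>x\<in>{0..<int n}. \<Sum>s\<in>{s \<in> S. (s * j) mod int n = x}. unity n ((s * j) mod int n))"
    by (rule sum.group[symmetric]) (use assms in auto)
  also have "\<dots> = (\<Sum>x\<in>{0..<int n}. of_nat (mult_count n S j x) * unity n x)"
    by (intro sum.cong) (auto simp: mult_count_def)
  finally show ?thesis .
qed

lemma eigenvalue_relation_coset_constant:
  fixes p k :: nat
  assumes p: "prime p" and fin: "finite S" "finite T"
    and rel: "of_int \<alpha> * eigenvalue_sum (p ^ Suc k) S i + of_int \<beta> * eigenvalue_sum (p ^ Suc k) T j
      + of_int \<gamma> = 0"
    and x: "x \<in> {0..<int (p ^ Suc k)}" and y: "y \<in> {0..<int (p ^ Suc k)}"
    and xy: "[x = y] (mod int (p ^ k))"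
  shows "\<alpha> * int (mult_count (p ^ Suc k) S i x) + \<beta> * int (mult_count (p ^ Suc k) T j x) + \<gamma> * of_bool (x = 0)
    = \<alpha> * int (mult_count (p ^ Suc k) S i y) + \<beta> * int (mult_count (p ^ Suc k) T j y) + \<gamma> * of_bool (y = 0)"
proof -
  define n where "n = p ^ Suc k"
  have n0: "n > 0" using p by (simp add: n_def prime_gt_0_nat)
  have "(\<Sum>x\<in>{0..<int n}. of_int (\<gamma> * of_bool (x = 0)) * unity n x) = (\<Sum>x\<in>{0::int}. of_int \<gamma>)"
    by (rule sum.mono_neutral_cong_right) (use n0 in auto)
  then have "(\<Sum>x\<in>{0..<int n}. of_int (\<alpha> * int (mult_count n S i x) + \<beta> * int (mult_count n T j x)
      + \<gamma> * of_bool (x = 0)) * unity n x) = of_int \<alpha> * eigenvalue_sum n S i + of_int \<beta> * eigenvalue_sum n T j + of_int \<gamma>"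
    unfolding eigenvalue_sum_conv_count[OF n0 fin(1)] eigenvalue_sum_conv_count[OF n0 fin(2)]
    by (simp add: algebra_simps sum.distrib sum_distrib_left)
  also have "\<dots> = 0" using rel by (simp add: n_def)
  finally show ?thesis
    unfolding n_def by (rule vanishing_sum_of_unity[OF p _ x y xy])
qed

text \<open>
Equal power sums give equal sums of \<open>q\<close> over both families for every polynomial \<open>q\<close>; a
polynomial that vanishes at all values except \<open>z\<close> isolates the multiplicity of \<open>z\<close>.
\<close>

lemma card_level_eq_of_power_sums:
  fixes f :: "'a \<Rightarrow> complex" and g :: "'b \<Rightarrow> complex"
  assumes fin: "finite A" "finite B" and eq: "\<And>k. (\<Sum>a\<in>A. f a ^ k) = (\<Sum>b\<in>B. g b ^ k)"
  shows "card {a \<in> A. f a = z} = card {b \<in> B. g b = z}"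
proof -
  define Z where "Z = f ` A \<union> g ` B - {z}"
  define q where "q = (\<Prod>w\<in>Z. [:- w, 1:])"
  have Z: "finite Z" using fin by (simp add: Z_def)
  have qz: "poly q w = 0 \<longleftrightarrow> w \<in> Z" for w
    using Z by (auto simp: q_def poly_prod)
  have level: "(\<Sum>a\<in>C. poly q (h a)) = of_nat (card {a \<in> C. h a = z}) * poly q z"
    if "finite C" "h ` C \<subseteq> insert z Z" for C :: "'c set" and h
  proof -
    have "(\<Sum>a\<in>C. poly q (h a)) = (\<Sum>a\<in>{a \<in> C. h a = z}. poly q (h a))"
      by (rule sum.mono_neutral_right) (use that qz in auto)
    also have "\<dots> = of_nat (card {a \<in> C. h a = z}) * poly q z" by simp
    finally show ?thesis .
  qed
  have im: "f ` A \<subseteq> insert z Z" "g ` B \<subseteq> insert z Z" by (auto simp: Z_def)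
  have "(\<Sum>a\<in>A. poly q (f a)) = (\<Sum>i\<le>degree q. coeff q i * (\<Sum>a\<in>A. f a ^ i))"
    unfolding poly_altdef sum_distrib_left by (rule sum.swap)
  also have "\<dots> = (\<Sum>b\<in>B. poly q (g b))"
    unfolding eq poly_altdef sum_distrib_left by (rule sum.swap)
  finally have "of_nat (card {a \<in> A. f a = z}) * poly q z = of_nat (card {b \<in> B. g b = z}) * poly q z"
    using level[OF fin(1), of f] level[OF fin(2), of g] im by simp
  moreover have "poly q z \<noteq> 0" using qz by (simp add: Z_def)
  ultimately show ?thesis by simp
qed

text \<open>
These are the entries of the \<open>k\<close>-th power of the adjacency matrix; complex values allow a direct
comparison of the trace with the power sums of the eigenvalues.
\<close>

fun walks :: "'a set \<Rightarrow> 'a rel \<Rightarrow> nat \<Rightarrow> 'a \<Rightarrow> 'a \<Rightarrow> complex" where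
  "walks V E 0 u v = of_bool (u = v)"
| "walks V E (Suc k) u v = (\<Sum>w\<in>V. of_bool ((u, w) \<in> E) * walks V E k w v)"

lemma walks_isomorphic:
  assumes f: "bij_betw f V V'"
    and E: "\<And>u v. u \<in> V \<Longrightarrow> v \<in> V \<Longrightarrow> (u, v) \<in> E \<longleftrightarrow> (f u, f v) \<in> E'"
    and "u \<in> V" "v \<in> V"
  shows "walks V' E' k (f u) (f v) = walks V E k u v"
  using assms(3)
proof (induction k arbitrary: u)
  case 0
  then show ?case using f \<open>v \<in> V\<close> by (auto simp: bij_betw_def inj_on_def)
next
  case (Suc k)
  have "walks V' E' (Suc k) (f u) (f v) = (\<Sum>w\<in>V. of_bool ((f u, f w) \<in> E') * walks V' E' k (f w) (f v))"
    by (simp add: sum.reindex_bij_betw[OF f, symmetric])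
  then show ?case using Suc E by simp
qed

lemma closed_walks_isomorphic:
  assumes f: "bij_betw f V V'"
    and E: "\<And>u v. u \<in> V \<Longrightarrow> v \<in> V \<Longrightarrow> (u, v) \<in> E \<longleftrightarrow> (f u, f v) \<in> E'"
  shows "(\<Sum>u\<in>V'. walks V' E' k u u) = (\<Sum>u\<in>V. walks V E k u u)"
  unfolding sum.reindex_bij_betw[OF f, symmetric]
  by (intro sum.cong refl walks_isomorphic[OF f E])

text \<open>
The Cayley digraph of the integers modulo \<open>n\<close> with connection set \<open>S\<close>; it is loopless if
\<open>S \<subseteq> {1..<int n}\<close>.
\<close>

definition circ :: "nat \<Rightarrow> int set \<Rightarrow> int pair_pre_digraph" where
  "circ n S = \<lparr>pverts = {0..<int n},
     parcs = {(u, v). u \<in> {0..<int n} \<and> v \<in> {0..<int n} \<and> (v - u) mod int n \<in> S}\<rparr>"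

lemma circ_sel [simp]: "pverts (circ n S) = {0..<int n}"
  "(u, v) \<in> parcs (circ n S) \<longleftrightarrow> u \<in> {0..<int n} \<and> v \<in> {0..<int n} \<and> (v - u) mod int n \<in> S"
  by (auto simp: circ_def)

text \<open>
The characters \<open>u \<mapsto> unity n (j * u)\<close> diagonalise the adjacency matrix simultaneously for all \<open>S\<close>.
\<close>

lemma walks_circ:
  assumes n: "n > 0" and S: "S \<subseteq> {0..<int n}" and u: "u \<in> {0..<int n}" and v: "v \<in> {0..<int n}"
  shows "of_nat n * walks {0..<int n} (parcs (circ n S)) k u v
    = (\<Sum>j\<in>{0..<int n}. eigenvalue_sum n S j ^ k * unity n (j * (u - v)))"
  using u
proof (induction k arbitrary: u)
  case 0
  have "int n dvd u - v \<longleftrightarrow> u = v"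
    using 0 v by (auto simp: mod_eq_dvd_iff[symmetric])
  then show ?case by (simp add: sum_unity_range[OF n])
next
  case (Suc k)
  let ?V = "{0..<int n}"
  have step: "(\<Sum>w\<in>?V. of_bool ((u, w) \<in> parcs (circ n S)) * unity n (j * (w - v)))
      = eigenvalue_sum n S j * unity n (j * (u - v))" for j
  proof -
    have "(\<Sum>w\<in>?V. of_bool ((u, w) \<in> parcs (circ n S)) * unity n (j * (w - v)))
        = (\<Sum>w\<in>{w \<in> ?V. (w - u) mod int n \<in> S}. unity n (j * (w - v)))"
      by (rule sum.mono_neutral_cong_right) (use Suc.prems in auto)
    also have "\<dots> = (\<Sum>s\<in>S. unity n (s * j + j * (u - v)))"
    proof (rule sum.reindex_bij_witness[of _ "\<lambda>s. (s + u) mod int n" "\<lambda>w. (w - u) mod int n"])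
      fix w assume w: "w \<in> {w \<in> ?V. (w - u) mod int n \<in> S}"
      show "((w - u) mod int n + u) mod int n = w" using w by (simp add: mod_simps)
      show "(w - u) mod int n \<in> S" using w by simp
      have "[(w - u) mod int n * j + j * (u - v) = (w - u) * j + j * (u - v)] (mod int n)"
        by (intro cong_add cong_mult cong_refl) (simp add: cong_def)
      then show "unity n ((w - u) mod int n * j + j * (u - v)) = unity n (j * (w - v))"
        using unity_cong[OF n] by (simp add: algebra_simps)
    next
      fix s assume s: "s \<in> S"
      show e: "((s + u) mod int n - u) mod int n = s" using s S by (auto simp: mod_simps)
      show "(s + u) mod int n \<in> {w \<in> ?V. (w - u) mod int n \<in> S}" using e s n by simp
    qed
    also have "\<dots> = eigenvalue_sum n S j * unity n (j * (u - v))"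
      by (simp add: unity_add eigenvalue_sum_def sum_distrib_right)
    finally show ?thesis .
  qed
  have "of_nat n * walks ?V (parcs (circ n S)) (Suc k) u v
      = (\<Sum>w\<in>?V. of_bool ((u, w) \<in> parcs (circ n S)) * (of_nat n * walks ?V (parcs (circ n S)) k w v))"
    by (simp only: walks.simps sum_distrib_left mult.left_commute)
  also have "\<dots> = (\<Sum>w\<in>?V. of_bool ((u, w) \<in> parcs (circ n S)) *
      (\<Sum>j\<in>?V. eigenvalue_sum n S j ^ k * unity n (j * (w - v))))"
    using Suc.IH by (intro sum.cong) auto
  also have "\<dots> = (\<Sum>j\<in>?V. eigenvalue_sum n S j ^ k *
      (\<Sum>w\<in>?V. of_bool ((u, w) \<in> parcs (circ n S)) * unity n (j * (w - v))))"
    unfolding sum_distrib_left by (subst sum.swap) (simp only: mult.left_commute)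
  finally show ?case unfolding step by (simp only: power_Suc mult.assoc mult.left_commute)
qed

lemma closed_walks_circ:
  assumes n: "n > 0" and S: "S \<subseteq> {0..<int n}"
  shows "(\<Sum>u\<in>{0..<int n}. walks {0..<int n} (parcs (circ n S)) k u u)
    = (\<Sum>j\<in>{0..<int n}. eigenvalue_sum n S j ^ k)"
proof -
  have "of_nat n * (\<Sum>u\<in>{0..<int n}. walks {0..<int n} (parcs (circ n S)) k u u)
    = (\<Sum>u\<in>{0..<int n}. \<Sum>j\<in>{0..<int n}. eigenvalue_sum n S j ^ k)"
    unfolding sum_distrib_left by (intro sum.cong refl) (simp add: walks_circ[OF n S])
  then show ?thesis using n by simp
qed

section \<open>Isomorphism and spectrum\<close>

lemma isomorphic_iff:
  assumes "pair_wf_digraph X" "pair_wf_digraph Y"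
  shows "isomorphic X Y \<longleftrightarrow> (\<exists>f. bij_betw f (pverts X) (pverts Y) \<and>
    (\<forall>u\<in>pverts X. \<forall>v\<in>pverts X. (u, v) \<in> parcs X \<longleftrightarrow> (f u, f v) \<in> parcs Y))"
proof
  assume "isomorphic X Y"
  then obtain h where h: "pre_digraph.digraph_isomorphism (with_proj X) h"
    and Y: "with_proj Y = app_iso h (with_proj X)"
    by (auto simp: isomorphic_def digraph_iso_def)
  define f where "f = iso_verts h"
  have V: "pverts Y = f ` pverts X" and A: "parcs Y = iso_arcs h ` parcs X"
    and tl: "iso_tail h = fst" and hd: "iso_head h = snd"
    using arg_cong[OF Y, of verts] arg_cong[OF Y, of arcs] arg_cong[OF Y, of tail]
      arg_cong[OF Y, of head] by (simp_all add: f_def)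
  have inj: "inj_on f (pverts X)"
    using h by (simp add: pre_digraph.digraph_isomorphism_def f_def)
  have arc: "iso_arcs h a = (f (fst a), f (snd a))" if "a \<in> parcs X" for a
    using h that by (auto simp: pre_digraph.digraph_isomorphism_def f_def tl hd prod_eq_iff)
  have "(u, v) \<in> parcs X \<longleftrightarrow> (f u, f v) \<in> parcs Y" if uv: "u \<in> pverts X" "v \<in> pverts X" for u v
  proof
    assume "(u, v) \<in> parcs X"
    then show "(f u, f v) \<in> parcs Y" using arc A by (metis fst_conv image_eqI snd_conv)
  next
    assume "(f u, f v) \<in> parcs Y"
    then obtain a where a: "a \<in> parcs X" "(f u, f v) = iso_arcs h a" using A by auto
    then have "f u = f (fst a)" "f v = f (snd a)" using arc by auto
    moreover have "fst a \<in> pverts X" "snd a \<in> pverts X"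
      using pair_wf_digraph.arc_fst_in_verts[OF assms(1) a(1)]
        pair_wf_digraph.arc_snd_in_verts[OF assms(1) a(1)] .
    ultimately have "u = fst a" "v = snd a" using inj uv by (auto dest: inj_onD)
    then show "(u, v) \<in> parcs X" using a by simp
  qed
  then show "\<exists>f. bij_betw f (pverts X) (pverts Y) \<and>
    (\<forall>u\<in>pverts X. \<forall>v\<in>pverts X. (u, v) \<in> parcs X \<longleftrightarrow> (f u, f v) \<in> parcs Y)"
    using inj V by (intro exI[of _ f]) (auto simp: bij_betw_def)
next
  assume "\<exists>f. bij_betw f (pverts X) (pverts Y) \<and>
    (\<forall>u\<in>pverts X. \<forall>v\<in>pverts X. (u, v) \<in> parcs X \<longleftrightarrow> (f u, f v) \<in> parcs Y)"
  then obtain f where f: "bij_betw f (pverts X) (pverts Y)"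
    and E: "\<And>u v. u \<in> pverts X \<Longrightarrow> v \<in> pverts X \<Longrightarrow> (u, v) \<in> parcs X \<longleftrightarrow> (f u, f v) \<in> parcs Y" by auto
  define h where "h = \<lparr>iso_verts = f, iso_arcs = map_prod f f, iso_head = snd, iso_tail = fst\<rparr>"
  have X: "parcs X \<subseteq> pverts X \<times> pverts X" and Y: "parcs Y \<subseteq> pverts Y \<times> pverts Y"
    using assms by (auto simp: pair_wf_digraph_def)
  have inj: "inj_on f (pverts X)" and im: "f ` pverts X = pverts Y" using f by (auto simp: bij_betw_def)
  have "inj_on (map_prod f f) (parcs X)"
    using map_prod_inj_on[OF inj inj] X by (rule inj_on_subset)
  moreover have "map_prod f f ` parcs X = parcs Y"
  proof (rule equalityI; rule subsetI)
    fix e assume "e \<in> map_prod f f ` parcs X"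
    then show "e \<in> parcs Y" using E X by auto
  next
    fix e assume e: "e \<in> parcs Y"
    then obtain u v where uv: "e = (f u, f v)" "u \<in> pverts X" "v \<in> pverts X" using Y im by blast
    then have "(u, v) \<in> parcs X" using e E by auto
    then show "e \<in> map_prod f f ` parcs X" using uv by force
  qed
  ultimately have "pre_digraph.digraph_isomorphism (with_proj X) h \<and> with_proj Y = app_iso h (with_proj X)"
    using inj im assms(1)
    by (auto simp: pre_digraph.digraph_isomorphism_def h_def wf_digraph_wp_iff app_iso_def with_proj_def
        simp flip: with_proj_def)
  then show "isomorphic X Y" by (auto simp: isomorphic_def digraph_iso_def)
qed

lemma wf_circ [simp]: "pair_wf_digraph (circ n S)"
  by unfold_locales (auto simp: circ_def)

lemma isomorphic_circ_iff:
  "isomorphic (circ n S) (circ n T) \<longleftrightarrow> (\<exists>f. bij_betw f {0..<int n} {0..<int n} \<and>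
     (\<forall>u\<in>{0..<int n}. \<forall>v\<in>{0..<int n}. (v - u) mod int n \<in> S \<longleftrightarrow> (f v - f u) mod int n \<in> T))"
proof -
  have "(\<forall>u\<in>{0..<int n}. \<forall>v\<in>{0..<int n}. (u, v) \<in> parcs (circ n S) \<longleftrightarrow> (f u, f v) \<in> parcs (circ n T))
      \<longleftrightarrow> (\<forall>u\<in>{0..<int n}. \<forall>v\<in>{0..<int n}. (v - u) mod int n \<in> S \<longleftrightarrow> (f v - f u) mod int n \<in> T)"
    if "bij_betw f {0..<int n} {0..<int n}" for f
  proof -
    have "f u \<in> {0..<int n}" if "u \<in> {0..<int n}" for u
      using that \<open>bij_betw f _ _\<close> bij_betwE by blast
    then show ?thesis by simp
  qed
  then show ?thesis
    by (subst isomorphic_iff[OF wf_circ wf_circ]) (auto simp only: circ_sel(1))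
qed

lemma isomorphic_circ_card:
  assumes n: "n > 0" and S: "S \<subseteq> {0..<int n}" and T: "T \<subseteq> {0..<int n}"
    and iso: "isomorphic (circ n S) (circ n T)"
  shows "card S = card T"
proof -
  obtain f where f: "bij_betw f {0..<int n} {0..<int n}"
    and E: "\<And>u v. u \<in> {0..<int n} \<Longrightarrow> v \<in> {0..<int n} \<Longrightarrow> (v - u) mod int n \<in> S \<longleftrightarrow> (f v - f u) mod int n \<in> T"
    using iso unfolding isomorphic_circ_iff by blast
  have f0: "f 0 \<in> {0..<int n}" using f n by (auto simp: bij_betw_def)
  have "bij_betw (\<lambda>v. (f v - f 0) mod int n) S T"
  proof (rule bij_betw_byWitness[of _ "\<lambda>w. inv_into {0..<int n} f ((w + f 0) mod int n)"])
    have inv: "inv_into {0..<int n} f v \<in> {0..<int n}" "f (inv_into {0..<int n} f v) = v"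
      if "v \<in> {0..<int n}" for v
      using that f by (metis bij_betw_def inv_into_into, metis bij_betw_def f_inv_into_f)
    have fin: "f v \<in> {0..<int n}" if "v \<in> {0..<int n}" for v using that f bij_betwE by blast
    show "\<forall>v\<in>S. inv_into {0..<int n} f (((f v - f 0) mod int n + f 0) mod int n) = v"
    proof
      fix v assume "v \<in> S"
      then have v: "v \<in> {0..<int n}" using S by auto
      then have "((f v - f 0) mod int n + f 0) mod int n = f v" using fin[OF v] by (simp add: mod_simps)
      then show "inv_into {0..<int n} f (((f v - f 0) mod int n + f 0) mod int n) = v"
        using v f by (simp add: bij_betw_def)
    qed
    show "\<forall>w\<in>T. (f (inv_into {0..<int n} f ((w + f 0) mod int n)) - f 0) mod int n = w"
    proof
      fix w assume "w \<in> T"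
      then have "w \<in> {0..<int n}" using T by auto
      then show "(f (inv_into {0..<int n} f ((w + f 0) mod int n)) - f 0) mod int n = w"
        using n by (subst inv) (auto simp: mod_simps)
    qed
    show "(\<lambda>v. (f v - f 0) mod int n) ` S \<subseteq> T"
    proof clarify
      fix v assume "v \<in> S"
      then show "(f v - f 0) mod int n \<in> T" using E[of 0 v] S n by auto
    qed
    show "(\<lambda>w. inv_into {0..<int n} f ((w + f 0) mod int n)) ` T \<subseteq> S"
    proof clarify
      fix w assume w: "w \<in> T"
      define v where "v = inv_into {0..<int n} f ((w + f 0) mod int n)"
      have v: "v \<in> {0..<int n}" "f v = (w + f 0) mod int n" using inv n by (auto simp: v_def)
      have "(f v - f 0) mod int n = w" using w T v by (auto simp: mod_simps)
      then show "v \<in> S" using E[of 0 v] v w n by auto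
    qed
  qed
  then show ?thesis by (rule bij_betw_same_card)
qed

text \<open>
The eigenvalue for \<open>j = 0\<close> is the valency, which an isomorphism preserves as well, so it can be
removed on both sides.
\<close>

lemma isomorphic_circ_spectrum:
  assumes n: "n > 0" and S: "S \<subseteq> {0..<int n}" and T: "T \<subseteq> {0..<int n}"
    and iso: "isomorphic (circ n S) (circ n T)"
  shows "card {j \<in> {1..<int n}. eigenvalue_sum n S j = z} = card {j \<in> {1..<int n}. eigenvalue_sum n T j = z}"
proof -
  obtain f where f: "bij_betw f {0..<int n} {0..<int n}"
    and E: "\<And>u v. u \<in> {0..<int n} \<Longrightarrow> v \<in> {0..<int n} \<Longrightarrow> (v - u) mod int n \<in> S \<longleftrightarrow> (f v - f u) mod int n \<in> T"
    using iso unfolding isomorphic_circ_iff by blast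
  have fin: "f v \<in> {0..<int n}" if "v \<in> {0..<int n}" for v using that f bij_betwE by blast
  have "(\<Sum>j\<in>{0..<int n}. eigenvalue_sum n S j ^ k) = (\<Sum>j\<in>{0..<int n}. eigenvalue_sum n T j ^ k)" for k
    unfolding closed_walks_circ[OF n S, symmetric] closed_walks_circ[OF n T, symmetric]
    by (rule closed_walks_isomorphic[OF f, symmetric]) (use E fin in simp)
  then have "card {j \<in> {0..<int n}. eigenvalue_sum n S j = z} = card {j \<in> {0..<int n}. eigenvalue_sum n T j = z}"
    by (intro card_level_eq_of_power_sums) auto
  moreover have "card {j \<in> {0..<int n}. eigenvalue_sum n U j = z}
      = card {j \<in> {1..<int n}. eigenvalue_sum n U j = z} + of_bool (of_nat (card U) = z)" for U
  proof -
    define J where "J = {j \<in> {1..<int n}. eigenvalue_sum n U j = z}"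
    have "{0..<int n} = insert 0 {1..<int n}" using n by auto
    moreover have "eigenvalue_sum n U 0 = of_nat (card U)" by (simp add: eigenvalue_sum_def)
    ultimately have "{j \<in> {0..<int n}. eigenvalue_sum n U j = z}
        = (if of_nat (card U) = z then {0} else {}) \<union> J"
      by (auto simp: J_def)
    moreover have "finite J" unfolding J_def by (rule finite_subset[of _ "{1..<int n}"]) auto
    moreover have "0 \<notin> J" by (simp add: J_def)
    ultimately have "card {j \<in> {0..<int n}. eigenvalue_sum n U j = z} = card J + of_bool (of_nat (card U) = z)"
      by simp
    then show ?thesis unfolding J_def .
  qed
  ultimately show ?thesis using isomorphic_circ_card[OF n S T iso] by simp
qed

lemma eigenvalue_matching:
  assumes "n > 0" "S \<subseteq> {0..<int n}" "T \<subseteq> {0..<int n}" "isomorphic (circ n S) (circ n T)"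
    and i: "i \<in> {1..<int n}"
  obtains j where "j \<in> {1..<int n}" "eigenvalue_sum n T j = eigenvalue_sum n S i"
proof -
  have "i \<in> {j \<in> {1..<int n}. eigenvalue_sum n S j = eigenvalue_sum n S i}" using i by simp
  then have "card {j \<in> {1..<int n}. eigenvalue_sum n S j = eigenvalue_sum n S i} \<noteq> 0"
    by (subst card_0_eq) (auto intro: finite_subset[of _ "{1..<int n}"])
  then have "card {j \<in> {1..<int n}. eigenvalue_sum n T j = eigenvalue_sum n S i} \<noteq> 0"
    by (subst isomorphic_circ_spectrum[OF assms(1-4), symmetric])
  then have "{j \<in> {1..<int n}. eigenvalue_sum n T j = eigenvalue_sum n S i} \<noteq> {}"
    by (metis card.empty)
  then show ?thesis using that by blast
qed

lemma mult_count_unit: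
  assumes n: "n > 0" and S: "S \<subseteq> {0..<int n}" and x: "x \<in> {0..<int n}" and ji: "[j * i = 1] (mod int n)"
  shows "mult_count n S j x = of_bool ((x * i) mod int n \<in> S)"
proof -
  have ij: "s * j * i mod int n = s" if "s \<in> {0..<int n}" for s
  proof -
    have "[s * (j * i) = s * 1] (mod int n)" using ji by (rule cong_scalar_left)
    then show ?thesis using that by (simp add: cong_def mult.assoc)
  qed
  have ij': "x * i * j mod int n = x"
    using ij[OF x] by (simp add: mult_ac)
  define y where "y = (x * i) mod int n"
  have "y * j mod int n = x" using ij' unfolding y_def by (metis mod_mult_left_eq)
  moreover have "s = y" if "s \<in> S" "(s * j) mod int n = x" for s
    using ij[of s] that S unfolding y_def by (metis mod_mult_left_eq subsetD)
  ultimately have "{s \<in> S. (s * j) mod int n = x} = {s. s = y \<and> y \<in> S}" by blast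
  then have "mult_count n S j x = of_bool (y \<in> S)" by (simp add: mult_count_def)
  then show ?thesis by (simp only: y_def)
qed

lemma mult_count_1:
  assumes "n > 0" "S \<subseteq> {0..<int n}" "x \<in> {0..<int n}"
  shows "mult_count n S 1 x = of_bool (x \<in> S)"
  using mult_count_unit[OF assms, of 1 1] assms(3) by simp

lemma mult_count_nonunit:
  assumes "d dvd j" "d dvd int n" "\<not> d dvd x"
  shows "mult_count n S j x = 0"
proof -
  have "d dvd (s * j) mod int n" for s
    using assms by (simp add: dvd_mod_iff)
  then have "{s \<in> S. (s * j) mod int n = x} = {}" using assms by auto
  then show ?thesis by (simp only: mult_count_def card.empty)
qed

lemma eigenvalue_sum_complement:
  assumes "S \<subseteq> {1..<int n}" "j \<in> {1..<int n}"
  shows "eigenvalue_sum n ({1..<int n} - S) j = - 1 - eigenvalue_sum n S j"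
proof -
  have n: "n > 0" using assms by auto
  have "{0..<int n} = insert 0 {1..<int n}" using n by auto
  then have "(\<Sum>s\<in>{0..<int n}. unity n (s * j)) = 1 + (\<Sum>s\<in>{1..<int n}. unity n (s * j))" by simp
  moreover have "(\<Sum>s\<in>{0..<int n}. unity n (s * j)) = 0"
    using assms sum_unity_range[OF n, of j] zdvd_imp_le[of "int n" j] by auto
  moreover have "(\<Sum>s\<in>{1..<int n}. unity n (s * j)) = eigenvalue_sum n S j + eigenvalue_sum n ({1..<int n} - S) j"
    unfolding eigenvalue_sum_def using assms by (subst sum.subset_diff[of S]) auto
  ultimately show ?thesis by (simp add: algebra_simps eq_neg_iff_add_eq_0)
qed

lemma eigenvalue_sum_mult_left:
  "m > 0 \<Longrightarrow> eigenvalue_sum (m * n) S (int m * j) = eigenvalue_sum n S j"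
  unfolding eigenvalue_sum_def by (intro sum.cong refl) (metis mult.left_commute unity_mult_left)

lemma eigenvalue_sum_cong:
  assumes "n > 0" "[i = j] (mod int n)"
  shows "eigenvalue_sum n S i = eigenvalue_sum n S j"
  unfolding eigenvalue_sum_def
  by (intro sum.cong refl unity_cong[OF assms(1)] cong_scalar_left assms(2))

text \<open>
The two sets of residues differ by an automorphism of the cyclic group; this is Cayley
isomorphism of the circulants.
\<close>

definition mult_equiv :: "nat \<Rightarrow> int set \<Rightarrow> int set \<Rightarrow> bool" where
  "mult_equiv n S T \<longleftrightarrow> (\<exists>m. coprime m (int n) \<and> (\<forall>x. x mod int n \<in> S \<longleftrightarrow> (x * m) mod int n \<in> T))"

lemma mult_equiv_refl: "mult_equiv n S S"
  unfolding mult_equiv_def by (intro exI[of _ 1]) simp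

lemma bij_mult_mod:
  assumes n: "n > 0" and m: "coprime m (int n)"
  shows "bij_betw (\<lambda>u. (u * m) mod int n) {0..<int n} {0..<int n}"
proof -
  have "inj_on (\<lambda>u. (u * m) mod int n) {0..<int n}"
  proof (rule inj_onI)
    fix u v assume uv: "u \<in> {0..<int n}" "v \<in> {0..<int n}" "(u * m) mod int n = (v * m) mod int n"
    then have "[u = v] (mod int n)" using m by (simp add: cong_mult_rcancel flip: cong_def)
    then show "u = v" using uv by (simp add: cong_def)
  qed
  moreover have "(\<lambda>u. (u * m) mod int n) ` {0..<int n} \<subseteq> {0..<int n}" using n by auto
  ultimately show ?thesis by (simp add: bij_betw_def endo_inj_surj)
qed

lemma mult_equiv_imp_isomorphic:
  assumes n: "n > 0" and "mult_equiv n S T"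
  shows "isomorphic (circ n S) (circ n T)"
proof -
  obtain m where m: "coprime m (int n)" and e: "\<And>x. x mod int n \<in> S \<longleftrightarrow> (x * m) mod int n \<in> T"
    using assms by (auto simp: mult_equiv_def)
  show ?thesis
    unfolding isomorphic_circ_iff
    by (intro exI[of _ "\<lambda>u. (u * m) mod int n"] conjI bij_mult_mod[OF n m])
       (simp add: e mod_simps left_diff_distrib)
qed

section \<open>Circulants of prime order and their wreath products\<close>

text \<open>
Modulo a prime all residues lie in one coset, so the difference of the indicator functions of \<open>S\<close>
and of the dilated set \<open>j * T\<close> is constant; it vanishes at \<open>0\<close>.
\<close>

lemma eigenvalue_eq_imp_mult_equiv:
  assumes p: "prime p" and S: "S \<subseteq> {1..<int p}" and T: "T \<subseteq> {1..<int p}"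
    and j: "\<not> int p dvd j" and eq: "eigenvalue_sum p S 1 = eigenvalue_sum p T j"
  shows "mult_equiv p S T"
proof -
  have p0: "p > 0" using p by (simp add: prime_gt_0_nat)
  have fin: "finite S" "finite T" using finite_subset[OF S] finite_subset[OF T] by simp_all
  have ST: "S \<subseteq> {0..<int p}" "T \<subseteq> {0..<int p}" using S T by auto
  have "coprime j (int p)" using prime_imp_coprime[of "int p" j] p j by (simp add: coprime_commute)
  then obtain i where i: "[j * i = 1] (mod int p)" using cong_solve_coprime_int by blast
  have "x \<in> S \<longleftrightarrow> (x * i) mod int p \<in> T" if x: "x \<in> {0..<int p}" for x
  proof -
    have "1 * int (mult_count (p ^ Suc 0) S 1 x) + (- 1) * int (mult_count (p ^ Suc 0) T j x) + 0 * of_bool (x = 0)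
        = 1 * int (mult_count (p ^ Suc 0) S 1 0) + (- 1) * int (mult_count (p ^ Suc 0) T j 0) + 0 * of_bool ((0::int) = 0)"
      by (rule eigenvalue_relation_coset_constant[OF p fin]) (use x p0 eq in simp_all)
    moreover have "mult_count p S 1 0 = 0" "mult_count p T j 0 = 0"
      using S T mult_count_1[OF p0 ST(1), of 0] mult_count_unit[OF p0 ST(2) _ i, of 0] p0 by auto
    ultimately show ?thesis
      using mult_count_1[OF p0 ST(1) x] mult_count_unit[OF p0 ST(2) x i] by (auto split: if_splits)
  qed
  then have "x mod int p \<in> S \<longleftrightarrow> (x * i) mod int p \<in> T" for x
    using p0 mod_mult_left_eq[of x "int p" i] by simp
  moreover have "coprime i (int p)"
    using i by (metis coprime_iff_invertible_int mult.commute)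
  ultimately show ?thesis unfolding mult_equiv_def by blast
qed

text \<open>
The connection set of the lexicographic product of a circulant with connection set \<open>A\<close> (between
the cosets of \<open>p\<int>\<close>) and one with connection set \<open>B\<close> (inside each coset).
\<close>

definition wreath :: "nat \<Rightarrow> int set \<Rightarrow> int set \<Rightarrow> int set" where
  "wreath p A B = {x \<in> {1..<int p ^ 2}. if int p dvd x then x div int p \<in> B else x mod int p \<in> A}"

lemma wreath_subset: "wreath p A B \<subseteq> {1..<int (p\<^sup>2)}"
  by (auto simp: wreath_def)

lemma sum_wreath:
  assumes p: "p > 0" and A: "A \<subseteq> {1..<int p}" and B: "B \<subseteq> {1..<int p}"
  shows "sum g (wreath p A B) = (\<Sum>b\<in>B. g (int p * b)) + (\<Sum>a\<in>A. \<Sum>t\<in>{0..<int p}. g (a + int p * t))"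
proof -
  have fin: "finite A" "finite B" "finite (wreath p A B)"
    by (rule finite_subset[OF A], simp, rule finite_subset[OF B], simp, rule finite_subset[OF wreath_subset], simp)
  have "sum g (wreath p A B) = sum g {x \<in> wreath p A B. int p dvd x} + sum g {x \<in> wreath p A B. \<not> int p dvd x}"
    using fin by (subst sum.union_disjoint[symmetric]) (auto intro: sum.cong)
  also have "sum g {x \<in> wreath p A B. int p dvd x} = (\<Sum>b\<in>B. g (int p * b))"
  proof (rule sum.reindex_bij_witness[of _ "\<lambda>b. int p * b" "\<lambda>x. x div int p"])
    fix b assume b: "b \<in> B"
    then have "0 < b" "b < int p" using B by auto
    then have "int p * b < int p * int p" "0 < int p * b" using p by simp_all
    then show "int p * b \<in> {x \<in> wreath p A B. int p dvd x}"
      using b p by (simp add: wreath_def power2_eq_square)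
  qed (use p in \<open>auto simp: wreath_def\<close>)
  also have "sum g {x \<in> wreath p A B. \<not> int p dvd x} = (\<Sum>(a, t)\<in>A \<times> {0..<int p}. g (a + int p * t))"
  proof (rule sum.reindex_bij_witness[of _ "\<lambda>(a, t). a + int p * t" "\<lambda>x. (x mod int p, x div int p)"])
    fix x assume "x \<in> {x \<in> wreath p A B. \<not> int p dvd x}"
    then have x: "x \<in> {1..<int p * int p}" "x mod int p \<in> A" by (auto simp: wreath_def power2_eq_square)
    have "\<not> int p \<le> x div int p"
    proof
      assume "int p \<le> x div int p"
      then have "int p * int p \<le> int p * (x div int p)" by (intro mult_left_mono) simp_all
      also have "\<dots> \<le> x" using p by (simp add: minus_mod_eq_mult_div[symmetric])
      finally show False using x by simp
    qed
    then show "(x mod int p, x div int p) \<in> A \<times> {0..<int p}"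
      using x p by (simp add: pos_imp_zdiv_nonneg_iff)
  next
    fix y assume "y \<in> A \<times> {0..<int p}"
    then obtain a t where y: "y = (a, t)" "a \<in> A" "0 \<le> t" "t < int p" by auto
    then have a: "0 < a" "a < int p" using A by auto
    have "int p * t + int p \<le> int p * int p"
      using mult_left_mono[of "t + 1" "int p" "int p"] y by (simp add: distrib_left)
    then have "a + int p * t < int p * int p" using a by linarith
    moreover have "0 < a + int p * t" using a y by (simp add: add_pos_nonneg)
    moreover have m: "(a + int p * t) mod int p = a" using a by simp
    ultimately show "(case y of (a, t) \<Rightarrow> a + int p * t) \<in> {x \<in> wreath p A B. \<not> int p dvd x}"
      using y a by (auto simp: wreath_def power2_eq_square dvd_eq_mod_eq_0)
    show "((case y of (a, t) \<Rightarrow> a + int p * t) mod int p, (case y of (a, t) \<Rightarrow> a + int p * t) div int p) = y"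
      using y a m by simp
  qed (auto simp: ac_simps)
  also have "\<dots> = (\<Sum>a\<in>A. \<Sum>t\<in>{0..<int p}. g (a + int p * t))"
    by (rule sum.cartesian_product[symmetric])
  finally show ?thesis .
qed

lemma card_wreath:
  assumes "p > 0" "A \<subseteq> {1..<int p}" "B \<subseteq> {1..<int p}"
  shows "card (wreath p A B) = card B + p * card A"
  using sum_wreath[OF assms, of "\<lambda>_. 1 :: nat"] by simp

text \<open>
The part of the connection set outside \<open>p\<int>\<close> is a union of cosets and contributes nothing.
\<close>

lemma eigenvalue_sum_wreath_unit:
  assumes p: "p > 0" and A: "A \<subseteq> {1..<int p}" and B: "B \<subseteq> {1..<int p}" and j: "\<not> int p dvd j"
  shows "eigenvalue_sum (p\<^sup>2) (wreath p A B) j = eigenvalue_sum p B j"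
proof -
  have u: "unity (p\<^sup>2) (int p * x) = unity p x" for x
    using unity_mult_left[OF p] by (simp add: power2_eq_square)
  have "(\<Sum>t\<in>{0..<int p}. unity (p\<^sup>2) ((a + int p * t) * j)) = 0" for a
  proof -
    have "(\<Sum>t\<in>{0..<int p}. unity (p\<^sup>2) ((a + int p * t) * j))
        = unity (p\<^sup>2) (a * j) * (\<Sum>t\<in>{0..<int p}. unity p (t * j))"
      by (simp add: distrib_right unity_add mult.assoc u sum_distrib_left)
    then show ?thesis using sum_unity_range[OF p, of j] j by simp
  qed
  then show ?thesis
    unfolding eigenvalue_sum_def sum_wreath[OF p A B] by (simp add: mult.assoc u)
qed

lemma eigenvalue_sum_wreath_nonunit:
  assumes p: "p > 0" and A: "A \<subseteq> {1..<int p}" and B: "B \<subseteq> {1..<int p}"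
  shows "eigenvalue_sum (p\<^sup>2) (wreath p A B) (int p * j) = of_nat (card B) + of_nat p * eigenvalue_sum p A j"
proof -
  have 1: "eigenvalue_sum (p\<^sup>2) (wreath p A B) (int p * j) = eigenvalue_sum p (wreath p A B) j"
    using eigenvalue_sum_mult_left[OF p] by (simp add: power2_eq_square)
  have "unity p (int p * b * j) = 1" for b using p by (simp add: unity_eq_1_iff)
  moreover have "unity p ((a + int p * t) * j) = unity p (a * j)" for a t
    by (rule unity_cong[OF p]) (simp add: cong_iff_dvd_diff algebra_simps)
  ultimately show ?thesis
    unfolding 1 unfolding eigenvalue_sum_def sum_wreath[OF p A B] by (simp add: sum_distrib_left)
qed

text \<open>
The eigenvalues of the inner factor occur with multiplicity at least \<open>p\<close>, whereas only \<open>p - 1\<close>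
nontrivial indices belong to the outer factor; so an inner eigenvalue matches an inner one. An
outer eigenvalue could match an inner one only if \<open>A\<close> is empty or full, and then \<open>A'\<close> equals
\<open>A\<close> by its cardinality.
\<close>

theorem isomorphic_wreath_imp_mult_equiv:
  assumes p: "prime p" "odd p"
    and A: "A \<subseteq> {1..<int p}" and B: "B \<subseteq> {1..<int p}"
    and A': "A' \<subseteq> {1..<int p}" and B': "B' \<subseteq> {1..<int p}"
    and iso: "isomorphic (circ (p\<^sup>2) (wreath p A B)) (circ (p\<^sup>2) (wreath p A' B'))"
  shows "mult_equiv p A A'" "mult_equiv p B B'"
proof -
  define n where "n = p\<^sup>2"
  define S S' where "S = wreath p A B" and "S' = wreath p A' B'"
  have p1: "p > 1" "p > 0" using p prime_gt_1_nat by (auto simp: prime_gt_0_nat)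
  have p3: "p \<ge> 3" using p prime_odd_nat[of p] prime_ge_2_nat[of p] by (cases "p = 2") auto
  have n: "n > 0" "int n = int p * int p" using p1 by (auto simp: n_def power2_eq_square)
  have SS: "S \<subseteq> {0..<int n}" "S' \<subseteq> {0..<int n}"
    using wreath_subset[of p A B] wreath_subset[of p A' B'] by (auto simp: S_def S'_def n_def)
  have iso: "isomorphic (circ n S) (circ n S')" using iso by (simp add: n_def S_def S'_def)
  have lamS: "\<not> int p dvd j \<Longrightarrow> eigenvalue_sum n S j = eigenvalue_sum p B j"
    "\<not> int p dvd j \<Longrightarrow> eigenvalue_sum n S' j = eigenvalue_sum p B' j"
    "eigenvalue_sum n S (int p * j) = of_nat (card B) + of_nat p * eigenvalue_sum p A j"
    "eigenvalue_sum n S' (int p * j) = of_nat (card B') + of_nat p * eigenvalue_sum p A' j" for j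
    unfolding S_def S'_def n_def
    using eigenvalue_sum_wreath_unit p1 A B A' B' eigenvalue_sum_wreath_nonunit by simp_all
  show "mult_equiv p B B'"
  proof -
    define z where "z = eigenvalue_sum p B 1"
    have ndv: "\<not> int p dvd 1 + int p * t" for t
      using p1 by (subst dvd_add_left_iff) auto
    have "(\<lambda>t. 1 + int p * t) ` {0..<int p} \<subseteq> {j \<in> {1..<int n}. eigenvalue_sum n S j = z}"
    proof clarify
      fix t assume t: "t \<in> {0..<int p}"
      have "int p * t + int p \<le> int p * int p"
        using mult_left_mono[of "t + 1" "int p" "int p"] t by (simp add: distrib_left)
      then have "1 + int p * t \<in> {1..<int n}" using t p1 n by auto
      moreover have "eigenvalue_sum p B (1 + int p * t) = z"
        unfolding z_def by (rule eigenvalue_sum_cong[OF p1(2)]) (simp add: cong_def)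
      ultimately show "1 + int p * t \<in> {1..<int n} \<and> eigenvalue_sum n S (1 + int p * t) = z"
        using lamS(1)[OF ndv] by simp
    qed
    then have "card ((\<lambda>t. 1 + int p * t) ` {0..<int p}) \<le> card {j \<in> {1..<int n}. eigenvalue_sum n S j = z}"
      by (intro card_mono finite_subset[of "{j \<in> {1..<int n}. _ j}" "{1..<int n}"]) auto
    moreover have "card ((\<lambda>t. 1 + int p * t) ` {0..<int p}) = p"
      using p1 by (subst card_image) (auto simp: inj_on_def)
    ultimately have ge: "p \<le> card {j \<in> {1..<int n}. eigenvalue_sum n S' j = z}"
      using isomorphic_circ_spectrum[OF n(1) SS iso, of z] by simp
    have "\<exists>j\<in>{1..<int n}. eigenvalue_sum n S' j = z \<and> \<not> int p dvd j"
    proof (rule ccontr)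
      assume "\<not> ?thesis"
      then have "{j \<in> {1..<int n}. eigenvalue_sum n S' j = z} \<subseteq> {j \<in> {1..<int n}. int p dvd j}" by auto
      also have "\<dots> \<subseteq> (\<lambda>t. int p * t) ` {1..<int p}"
      proof (rule subsetI)
        fix j assume "j \<in> {j \<in> {1..<int n}. int p dvd j}"
        then obtain t where t: "j = int p * t" "j \<in> {1..<int n}" by auto
        then have "0 < int p * t" "int p * t < int p * int p" using n by auto
        then have "0 < t" "t < int p" by (auto simp: zero_less_mult_iff)
        then show "j \<in> (\<lambda>t. int p * t) ` {1..<int p}" using t by auto
      qed
      finally have "card {j \<in> {1..<int n}. eigenvalue_sum n S' j = z} \<le> card {1..<int p}"
        by (meson card_image_le card_mono finite_atLeastLessThan_int finite_imageI le_trans)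
      then show False using ge p1 by simp
    qed
    then obtain j where "\<not> int p dvd j" "eigenvalue_sum p B' j = z" using lamS(2) by auto
    then show ?thesis using eigenvalue_eq_imp_mult_equiv[OF p(1) B B'] by (simp add: z_def)
  qed
  show "mult_equiv p A A'"
  proof -
    have fin: "finite A" "finite B" "finite A'" "finite B'" using finite_subset[OF A] finite_subset[OF B] finite_subset[OF A'] finite_subset[OF B'] by simp_all
    have cB: "card B \<le> p - 1" "card B' \<le> p - 1"
      using card_mono[OF _ B] card_mono[OF _ B'] by auto
    have "card B + p * card A = card B' + p * card A'"
      using isomorphic_circ_card[OF n(1) SS iso] p1 A B A' B' by (simp add: S_def S'_def card_wreath)
    then have "(card B + p * card A) mod p = (card B' + p * card A') mod p"
      "(card B + p * card A) div p = (card B' + p * card A') div p" by simp_all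
    then have cc: "card B = card B'" "card A = card A'" using cB p1 by simp_all
    have "int p \<in> {1..<int n}" using p1 n by simp
    then obtain i where i: "i \<in> {1..<int n}" "eigenvalue_sum n S' i = eigenvalue_sum n S (int p)"
      using eigenvalue_matching[OF n(1) SS iso] by metis
    then have i2: "eigenvalue_sum n S' i = of_nat (card B) + of_nat p * eigenvalue_sum p A 1"
      using lamS(3)[of 1] by simp
    show ?thesis
    proof (cases "int p dvd i")
      case True
      then obtain j where j: "i = int p * j" by auto
      have "\<not> int p dvd j"
      proof
        assume "int p dvd j"
        then have "int n dvd i" using j n by simp
        then show False using i zdvd_imp_le[of "int n" i] by auto
      qed
      moreover have "eigenvalue_sum p A 1 = eigenvalue_sum p A' j"
        using i2 lamS(4)[of j] j cc p1 by simp
      ultimately show ?thesis using eigenvalue_eq_imp_mult_equiv[OF p(1) A A'] by simp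
    next
      case False
      define b where "b = int (card B)"
      have AB: "A \<subseteq> {0..<int p}" "B' \<subseteq> {0..<int p}" using A B' by auto
      have "coprime i (int p)" using prime_imp_coprime[of "int p" i] p(1) False by (simp add: coprime_commute)
      then obtain m where m: "[i * m = 1] (mod int p)" using cong_solve_coprime_int by blast
      have rel: "int p * of_bool (x \<in> A) - of_bool ((x * m) mod int p \<in> B') = b" if x: "x \<in> {1..<int p}" for x
      proof -
        have "int p * int (mult_count (p ^ Suc 0) A 1 x) + (- 1) * int (mult_count (p ^ Suc 0) B' i x) + b * of_bool (x = 0)
            = int p * int (mult_count (p ^ Suc 0) A 1 0) + (- 1) * int (mult_count (p ^ Suc 0) B' i 0) + b * of_bool ((0::int) = 0)"
          by (rule eigenvalue_relation_coset_constant[OF p(1) fin(1,4)])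
             (use x p1 i2 lamS(2)[OF False] b_def in simp_all)
        then show ?thesis
          using mult_count_1[OF p1(2) AB(1)] mult_count_unit[OF p1(2) AB(2) _ m] x A B' by auto
      qed
      have b: "0 \<le> b" "b \<le> int p - 1" using cB p1 by (auto simp: b_def)
      have "A = {} \<or> A = {1..<int p}"
      proof (cases "b = 0")
        case True
        then have "x \<notin> A" if "x \<in> {1..<int p}" for x using rel[OF that] p3 by (auto simp: of_bool_def split: if_splits)
        then show ?thesis using A by blast
      next
        case bn: False
        then have "x \<in> A" if "x \<in> {1..<int p}" for x using rel[OF that] b by (cases "x \<in> A") auto
        then show ?thesis using A by blast
      qed
      then have "A' = A" using cc(2) fin A' card_subset_eq[OF _ A'] by auto
      then show ?thesis using mult_equiv_refl by simp
    qed
  qed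
qed

section \<open>Multipliers that exchange a set and its complement\<close>

text \<open>
Starting from an exponent with \<open>m ^ N = 1\<close>, halve it as long as it is even and the value stays \<open>1\<close>;
the first other value is a square root of \<open>1\<close>, and \<open>1\<close> and \<open>-1\<close> are the only ones.
\<close>

lemma power_eq_minus_one_prime_power:
  fixes p r :: nat and m :: int
  assumes p: "prime p" "odd p" and m: "coprime m (int p)"
  obtains e where "[m ^ e = - 1] (mod int (p ^ r)) \<or> odd e \<and> [m ^ e = 1] (mod int (p ^ r))"
proof -
  let ?n = "int (p ^ r)"
  have p2: "p \<noteq> 2" using p by auto
  have sq: "[y = 1] (mod ?n) \<or> [y = - 1] (mod ?n)" if "[y * y = 1] (mod ?n)" for y
  proof -
    have d: "?n dvd (y - 1) * (y + 1)" using that by (simp add: cong_iff_dvd_diff algebra_simps)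
    have nd: "\<not> (int p dvd y - 1 \<and> int p dvd y + 1)"
    proof
      assume a: "int p dvd y - 1 \<and> int p dvd y + 1"
      have "int p dvd (y + 1) - (y - 1)" by (rule dvd_diff) (use a in blast)+
      then have "int p dvd 2" by simp
      then have "p dvd 2" by presburger
      then show False using p p2 primes_dvd_imp_eq two_is_prime_nat by blast
    qed
    have cop: "coprime ?n z" if "\<not> int p dvd z" for z
      using prime_imp_coprime[of "int p" z] that p by simp
    show ?thesis
    proof (cases "int p dvd y - 1")
      case True
      then have "?n dvd y - 1" using nd cop d coprime_dvd_mult_left_iff by blast
      then show ?thesis by (simp add: cong_iff_dvd_diff)
    next
      case False
      then have "?n dvd y + 1" using cop d coprime_dvd_mult_right_iff by blast
      then show ?thesis by (simp add: cong_iff_dvd_diff)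
    qed
  qed
  define N where "N = totient (p ^ r)"
  have N: "N > 0" using p by (simp add: N_def prime_gt_0_nat)
  have "[m ^ N = 1] (mod ?n)"
  proof -
    define k where "k = nat (m mod ?n)"
    have pos: "?n > 0" using p by (simp add: prime_gt_0_nat)
    have k: "int k = m mod ?n" using pos by (simp add: k_def)
    have "coprime m ?n" using m by simp
    then have "coprime (int k) ?n" unfolding k using pos by (subst coprime_mod_left_iff) simp_all
    then have "coprime k (p ^ r)" by (simp only: coprime_int_iff)
    then have "[k ^ N = 1] (mod p ^ r)" unfolding N_def by (rule euler_theorem)
    then have "[int (k ^ N) = int 1] (mod ?n)" by (simp only: cong_int_iff)
    moreover have "[int k ^ N = m ^ N] (mod ?n)" unfolding k by (intro cong_pow) (simp add: cong_def)
    ultimately show ?thesis by (metis cong_sym cong_trans of_nat_1 of_nat_power)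
  qed
  with N show ?thesis
  proof (induction N rule: less_induct)
    case (less N)
    show ?case
    proof (cases "odd N")
      case True
      then show ?thesis using that less.prems by blast
    next
      case False
      then obtain M where M: "N = M + M" by (metis evenE mult_2)
      then have "[m ^ M * m ^ M = 1] (mod ?n)" using less.prems by (simp add: power_add)
      then show ?thesis using sq[of "m ^ M"] less.IH[of M] less.prems M that by fastforce
    qed
  qed
qed

text \<open>
A multiplier that negates \<open>f\<close> forces \<open>f\<close> to be even or odd: the power of the multiplier that equals
\<open>-1\<close> changes the sign of \<open>f\<close> by the parity of the exponent. The alternative of an odd power equal to \<open>1\<close>
would give \<open>f = - f\<close>, so then \<open>D\<close> is empty.
\<close>

lemma sign_of_multiplier:
  fixes p r :: nat and f :: "int \<Rightarrow> int" and D :: "int \<Rightarrow> bool"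
  assumes p: "prime p" "odd p" and m: "coprime m (int p)"
    and per: "\<And>x y. [x = y] (mod int (p ^ r)) \<Longrightarrow> f x = f y"
    and step: "\<And>x. D x \<Longrightarrow> D (x * m) \<and> f (x * m) = - f x"
    and nz: "\<And>x. D x \<Longrightarrow> f x \<noteq> 0"
  obtains \<epsilon> where "\<epsilon> \<in> {1, - 1}" "\<And>x. D x \<Longrightarrow> f (- x) = \<epsilon> * f x"
proof -
  have iter: "D (x * m ^ e) \<and> f (x * m ^ e) = (- 1) ^ e * f x" if "D x" for x e
  proof (induction e)
    case (Suc e)
    then show ?case using step[of "x * m ^ e"] by (simp add: mult_ac)
  qed (use that in simp)
  obtain e where e: "[m ^ e = - 1] (mod int (p ^ r)) \<or> odd e \<and> [m ^ e = 1] (mod int (p ^ r))"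
    using power_eq_minus_one_prime_power[OF p m] by blast
  then show ?thesis
  proof
    assume e: "[m ^ e = - 1] (mod int (p ^ r))"
    have "f (- x) = (- 1) ^ e * f x" if "D x" for x
    proof -
      have "[x * m ^ e = x * (- 1)] (mod int (p ^ r))" using e by (rule cong_scalar_left)
      then show ?thesis using per iter[OF that, of e] by fastforce
    qed
    moreover have "(- 1) ^ e \<in> {1, - 1 :: int}" by (cases "even e") auto
    ultimately show ?thesis using that by blast
  next
    assume e: "odd e \<and> [m ^ e = 1] (mod int (p ^ r))"
    have "\<not> D x" for x
    proof
      assume "D x"
      have "[x * m ^ e = x * 1] (mod int (p ^ r))" using e by (intro cong_scalar_left) simp
      then have "f (x * m ^ e) = f x" using per by fastforce
      then show False using iter[OF \<open>D x\<close>, of e] nz[OF \<open>D x\<close>] e by simp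
    qed
    then show ?thesis using that[of 1] by simp
  qed
qed

text \<open>
With values \<open>1\<close> and \<open>-1\<close> instead of a membership predicate, complementing the set is negating the
function. Undirected circulants and tournaments are those whose sign function is even or
odd away from \<open>0\<close>.
\<close>

definition sgn_mod :: "nat \<Rightarrow> int set \<Rightarrow> int \<Rightarrow> int" where
  "sgn_mod n S x = (if x mod int n \<in> S then 1 else - 1)"

lemma sgn_mod_cong: "[x = y] (mod int n) \<Longrightarrow> sgn_mod n S x = sgn_mod n S y"
  by (simp add: sgn_mod_def cong_def)

lemma mod_in_nonzero_residues:
  assumes "n > 0" "\<not> int n dvd x"
  shows "x mod int n \<in> {1..<int n}"
proof -
  have "x mod int n \<noteq> 0" using assms by (simp add: dvd_eq_mod_eq_0)
  moreover have "0 \<le> x mod int n" "x mod int n < int n" using assms(1) by simp_all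
  ultimately show ?thesis unfolding atLeastLessThan_iff by linarith
qed

lemma undirected_circ_iff:
  assumes n: "n > 0" and S: "S \<subseteq> {1..<int n}"
  shows "undirected (circ n S) \<longleftrightarrow> (\<forall>x. \<not> int n dvd x \<longrightarrow> sgn_mod n S (- x) = sgn_mod n S x)"
proof
  assume u: "undirected (circ n S)"
  have sym: "(v, u) \<in> parcs (circ n S)" if "(u, v) \<in> parcs (circ n S)" for u v
    using u that by (auto simp: undirected_def symmetric_def sym_def simp del: circ_sel)
  have 1: "(- x) mod int n \<in> S" if "x mod int n \<in> S" for x
    using sym[of 0 "x mod int n"] that n by (simp add: mod_simps)
  show "\<forall>x. \<not> int n dvd x \<longrightarrow> sgn_mod n S (- x) = sgn_mod n S x"
    using 1 1[of "- _"] by (auto simp: sgn_mod_def)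
next
  assume s: "\<forall>x. \<not> int n dvd x \<longrightarrow> sgn_mod n S (- x) = sgn_mod n S x"
  have "(u - v) mod int n \<in> S" if "(v - u) mod int n \<in> S" for u v
  proof -
    have "\<not> int n dvd v - u" using that S by (auto simp: dvd_eq_mod_eq_0)
    then have "sgn_mod n S (- (v - u)) = sgn_mod n S (v - u)" using s by blast
    then show ?thesis using that by (simp add: sgn_mod_def split: if_splits)
  qed
  then show "undirected (circ n S)"
    by (auto simp: undirected_def symmetric_def sym_def)
qed

lemma tournament_circ_iff:
  assumes n: "n > 0" and S: "S \<subseteq> {1..<int n}"
  shows "tournament (circ n S) \<longleftrightarrow> (\<forall>x. \<not> int n dvd x \<longrightarrow> sgn_mod n S (- x) = - sgn_mod n S x)"
proof
  assume t: "tournament (circ n S)"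
  have "((- x) mod int n \<in> S) \<noteq> (x mod int n \<in> S)" if "\<not> int n dvd x" for x
  proof -
    have "x mod int n \<in> {1..<int n}" using n that by (rule mod_in_nonzero_residues)
    then have "((0, x mod int n) \<in> parcs (circ n S)) \<noteq> ((x mod int n, 0) \<in> parcs (circ n S))"
      using t[unfolded tournament_def, THEN bspec[of _ _ 0], THEN bspec[of _ _ "x mod int n"]] by simp
    then show ?thesis using n by (simp add: mod_simps)
  qed
  then show "\<forall>x. \<not> int n dvd x \<longrightarrow> sgn_mod n S (- x) = - sgn_mod n S x"
    by (auto simp: sgn_mod_def)
next
  assume s: "\<forall>x. \<not> int n dvd x \<longrightarrow> sgn_mod n S (- x) = - sgn_mod n S x"
  show "tournament (circ n S)"
    unfolding tournament_def
  proof (intro ballI impI)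
    fix u v assume uv: "u \<in> pverts (circ n S)" "v \<in> pverts (circ n S)" "u \<noteq> v"
    then have "\<not> int n dvd v - u" by (auto simp: mod_eq_dvd_iff[symmetric])
    then have "sgn_mod n S (- (v - u)) = - sgn_mod n S (v - u)" using s by blast
    then show "((u, v) \<in> parcs (circ n S)) \<noteq> ((v, u) \<in> parcs (circ n S))"
      using uv by (simp add: sgn_mod_def split: if_splits)
  qed
qed

lemma complement_circ:
  assumes n: "n > 0" and S: "S \<subseteq> {1..<int n}"
  shows "complement (circ n S) = circ n ({1..<int n} - S)"
proof -
  have "u \<noteq> v \<longleftrightarrow> (v - u) mod int n \<in> {1..<int n}" if "u \<in> {0..<int n}" "v \<in> {0..<int n}" for u v
  proof -
    have "u \<noteq> v \<longleftrightarrow> \<not> int n dvd v - u"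
      using that by (auto simp: mod_eq_dvd_iff[symmetric])
    also have "\<dots> \<longleftrightarrow> (v - u) mod int n \<in> {1..<int n}"
      using mod_in_nonzero_residues[OF n] by auto
    finally show ?thesis .
  qed
  then show ?thesis by (auto simp: complement_def circ_def)
qed

lemma mult_equiv_complement_imp:
  assumes p: "prime p" "odd p" and r: "r > 0" and S: "S \<subseteq> {1..<int (p ^ r)}"
    and eq: "mult_equiv (p ^ r) S ({1..<int (p ^ r)} - S)"
  shows "undirected (circ (p ^ r) S) \<or> tournament (circ (p ^ r) S)"
proof -
  let ?n = "p ^ r"
  have n: "?n > 0" using p by (simp add: prime_gt_0_nat)
  obtain m where m: "coprime m (int ?n)" and e: "\<And>x. x mod int ?n \<in> S \<longleftrightarrow> (x * m) mod int ?n \<in> {1..<int ?n} - S"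
    using eq by (auto simp: mult_equiv_def)
  have mp: "coprime m (int p)" using m r by simp
  have step: "\<not> int ?n dvd x * m \<and> sgn_mod ?n S (x * m) = - sgn_mod ?n S x" if "\<not> int ?n dvd x" for x
  proof -
    have nd: "\<not> int ?n dvd x * m" using that m by (metis coprime_commute coprime_dvd_mult_left_iff)
    then have "(x * m) mod int ?n \<in> {1..<int ?n}" by (rule mod_in_nonzero_residues[OF n])
    then show ?thesis using e[of x] nd by (simp add: sgn_mod_def)
  qed
  have nz: "sgn_mod ?n S x \<noteq> 0" for x by (simp add: sgn_mod_def)
  obtain \<epsilon> where "\<epsilon> \<in> {1, - 1}" "\<And>x. \<not> int ?n dvd x \<Longrightarrow> sgn_mod ?n S (- x) = \<epsilon> * sgn_mod ?n S x"
    using sign_of_multiplier[of p m r "sgn_mod ?n S" "\<lambda>x. \<not> int ?n dvd x", OF p mp sgn_mod_cong step nz]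
    by blast
  then show ?thesis unfolding undirected_circ_iff[OF n S] tournament_circ_iff[OF n S] by auto
qed

section \<open>Self-complementary circulants of order p squared\<close>

lemma sum_sgn_mod_coset:
  fixes p :: nat
  assumes p: "p > 0" and S: "S \<subseteq> {0..<int (p\<^sup>2)}" and u: "u \<in> {1, - 1}"
  shows "(\<Sum>t\<in>{0..<int p}. sgn_mod (p\<^sup>2) S (x + u * (int p * t)))
    = 2 * int (card {s \<in> S. s mod int p = x mod int p}) - int p"
proof -
  let ?P = "\<lambda>t. (x + u * (int p * t)) mod int (p\<^sup>2) \<in> S"
  have n: "int (p\<^sup>2) = int p * int p" by (simp add: power2_eq_square)
  have uu: "u * u = 1" using u by auto
  have "card {t \<in> {0..<int p}. ?P t} = card {s \<in> S. s mod int p = x mod int p}"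
  proof (rule bij_betw_same_card[of "\<lambda>t. (x + u * (int p * t)) mod int (p\<^sup>2)"],
      rule bij_betw_byWitness[of _ "\<lambda>s. (u * ((s - x) div int p)) mod int p"])
    show "\<forall>t\<in>{t \<in> {0..<int p}. ?P t}. (u * (((x + u * (int p * t)) mod int (p\<^sup>2) - x) div int p)) mod int p = t"
    proof
      fix t assume t: "t \<in> {t \<in> {0..<int p}. ?P t}"
      obtain k where k: "(x + u * (int p * t)) mod int (p\<^sup>2) = x + u * (int p * t) + int p * int p * k"
        unfolding n by (metis minus_mult_div_eq_mod mult_minus_right uminus_add_conv_diff add.commute)
      have "(x + u * (int p * t)) mod int (p\<^sup>2) - x = int p * (u * t + int p * k)"
        unfolding k by (simp add: algebra_simps)
      then have "u * (((x + u * (int p * t)) mod int (p\<^sup>2) - x) div int p) = u * (u * t + int p * k)"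
        using p by simp
      also have "\<dots> = t + int p * (u * k)"
        using uu by (simp add: distrib_left mult.left_commute flip: mult.assoc)
      finally show "(u * (((x + u * (int p * t)) mod int (p\<^sup>2) - x) div int p)) mod int p = t"
        using t by simp
    qed
    have inv: "(x + u * (int p * ((u * ((s - x) div int p)) mod int p))) mod int (p\<^sup>2) = s"
      if s: "s \<in> {s \<in> S. s mod int p = x mod int p}" for s
    proof -
      obtain w where w: "s - x = int p * w"
        using s by (metis (mono_tags, lifting) dvdE mem_Collect_eq mod_eq_dvd_iff)
      obtain k where k: "(u * w) mod int p = u * w + int p * k"
        by (metis minus_mult_div_eq_mod mult_minus_right uminus_add_conv_diff add.commute)
      have "x + u * (int p * ((u * ((s - x) div int p)) mod int p)) = x + u * (int p * (u * w + int p * k))"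
        using p by (simp add: w k)
      also have "\<dots> = x + (u * u) * (int p * w) + int p * int p * (u * k)"
        by (simp add: algebra_simps)
      also have "\<dots> = s + int (p\<^sup>2) * (u * k)" using uu w by (simp only: n)
      finally show ?thesis using s S by auto
    qed
    show "\<forall>s\<in>{s \<in> S. s mod int p = x mod int p}.
        (x + u * (int p * ((u * ((s - x) div int p)) mod int p))) mod int (p\<^sup>2) = s"
      using inv by blast
    show "(\<lambda>s. (u * ((s - x) div int p)) mod int p) ` {s \<in> S. s mod int p = x mod int p} \<subseteq> {t \<in> {0..<int p}. ?P t}"
      using inv p by auto
    show "(\<lambda>t. (x + u * (int p * t)) mod int (p\<^sup>2)) ` {t \<in> {0..<int p}. ?P t} \<subseteq> {s \<in> S. s mod int p = x mod int p}"
    proof (rule image_subsetI)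
      fix t assume t: "t \<in> {t \<in> {0..<int p}. ?P t}"
      have "(x + u * (int p * t)) mod int (p\<^sup>2) mod int p = (x + u * (int p * t)) mod int p"
        unfolding n by (rule mod_mod_cancel) simp
      also have "\<dots> = x mod int p" by (simp add: mod_eq_dvd_iff)
      finally show "(x + u * (int p * t)) mod int (p\<^sup>2) \<in> {s \<in> S. s mod int p = x mod int p}"
        using t by blast
    qed
  qed
  moreover have "(\<Sum>t\<in>{0..<int p}. sgn_mod (p\<^sup>2) S (x + u * (int p * t)))
      = (\<Sum>t\<in>{0..<int p}. 2 * of_bool (?P t) - 1)"
    by (intro sum.cong) (auto simp: sgn_mod_def)
  moreover have "\<dots> = 2 * int (card {t \<in> {0..<int p}. ?P t}) - int p"
    by (simp add: sum_subtractf flip: sum_distrib_left) (simp add: Int_def conj_commute)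
  ultimately show ?thesis by simp
qed

text \<open>
A sum of \<open>p\<close> signs is extremal only if all signs are equal.
\<close>

lemma sgn_mod_eq_of_coset_sum:
  assumes d: "d \<in> {1, - 1}" and s: "(\<Sum>t\<in>{0..<int p}. sgn_mod n S (g t)) = d * int p" and t: "t \<in> {0..<int p}"
  shows "sgn_mod n S (g t) = d"
proof -
  have dd: "d * d = 1" using d by auto
  have "(\<Sum>t\<in>{0..<int p}. 1 - d * sgn_mod n S (g t)) = 0"
    by (simp add: sum_subtractf s dd flip: sum_distrib_left mult.assoc)
  moreover have "0 \<le> 1 - d * sgn_mod n S (g t)" for t using d by (auto simp: sgn_mod_def)
  ultimately have "1 - d * sgn_mod n S (g t) = 0"
    using t by (subst (asm) sum_nonneg_eq_0_iff) auto
  then show ?thesis using d by auto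
qed

text \<open>
The hypotheses on \<open>x0\<close> and \<open>x1\<close> say that some coset of \<open>p\<int>\<close> other than \<open>p\<int>\<close> is neither contained
in \<open>S\<close> nor disjoint from it. The conclusion with \<open>\<epsilon> = 1\<close> means undirected, with \<open>\<epsilon> = -1\<close> a tournament.
The partner of \<open>\<lambda>\<^sub>1\<close> controls only the partial cosets and \<open>p\<int>\<close>, because on the other cosets the
relation between eigenvalues is blind; the partner of \<open>\<lambda>\<^sub>p\<close> sees the number of elements in each
coset, which is all there is to know about the full and the empty ones.
\<close>

lemma self_complementary_sign_if_not_coset_closed:
  fixes p :: nat
  assumes p: "prime p" "odd p" and S: "S \<subseteq> {1..<int (p\<^sup>2)}"
    and iso: "isomorphic (circ (p\<^sup>2) S) (circ (p\<^sup>2) ({1..<int (p\<^sup>2)} - S))"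
    and x01: "[x0 = x1] (mod int p)" "\<not> int p dvd x0" "x0 mod int (p\<^sup>2) \<in> S" "x1 mod int (p\<^sup>2) \<notin> S"
  shows "\<exists>\<epsilon>\<in>{1, - 1}. \<forall>x. \<not> int (p\<^sup>2) dvd x \<longrightarrow> sgn_mod (p\<^sup>2) S (- x) = \<epsilon> * sgn_mod (p\<^sup>2) S x"
proof -
  define n where "n = p\<^sup>2"
  define inS where "inS x = (x mod int n \<in> S)" for x
  have p0: "p > 1" "p > 0" using p prime_gt_1_nat by (auto simp: prime_gt_0_nat)
  have n: "n > 0" "int n = int p * int p" "n = p ^ Suc 1" "n = p * p" "int p dvd int n"
    using p0 by (auto simp: n_def power2_eq_square)
  have S1: "S \<subseteq> {1..<int n}" and S0: "S \<subseteq> {0..<int n}" "{1..<int n} - S \<subseteq> {0..<int n}"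
    using S by (auto simp: n_def)
  have fin: "finite S" using finite_subset[OF S0(1)] by simp
  have iso: "isomorphic (circ n S) (circ n ({1..<int n} - S))" using iso by (simp add: n_def)
  have modp: "x mod int n mod int p = x mod int p" for x using n(5) by (rule mod_mod_cancel)
  have dvdp: "int p dvd x mod int n \<longleftrightarrow> int p dvd x" for x using n(5) by (rule dvd_mod_iff)
  have rng: "x mod int n \<in> {0..<int n}" for x using n by simp
  have partner: "\<exists>j\<in>{1..<int n}. eigenvalue_sum n S i + eigenvalue_sum n S j = - 1"
    if i: "i \<in> {1..<int n}" for i
  proof -
    obtain j where j: "j \<in> {1..<int n}" "eigenvalue_sum n ({1..<int n} - S) j = eigenvalue_sum n S i"
      using eigenvalue_matching[OF n(1) S0 iso i] by blast
    then show ?thesis using eigenvalue_sum_complement[OF S1 j(1)]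
      by (intro bexI[of _ j]) (auto simp: algebra_simps)
  qed
  have rel: "int (mult_count n S i x) + int (mult_count n S j x) + of_bool (x = 0)
      = int (mult_count n S i y) + int (mult_count n S j y) + of_bool (y = 0)"
    if "eigenvalue_sum n S i + eigenvalue_sum n S j = - 1" "x \<in> {0..<int n}" "y \<in> {0..<int n}"
      "[x = y] (mod int p)" for i j x y
    using eigenvalue_relation_coset_constant[OF p(1) fin fin, of 1 1 i 1 j 1 x y] that
    unfolding n(3)[symmetric] by simp
  have inv: "\<exists>k. [i * k = 1] (mod int n)" if "\<not> int p dvd i" for i
  proof -
    have "coprime i (int p)" using prime_imp_coprime[of "int p" i] p that by (simp add: coprime_commute)
    then have "coprime i (int n)" unfolding n by simp
    then show ?thesis by (rule cong_solve_coprime_int)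
  qed
  \<comment> \<open>The partner of an index prime to \<open>p\<close> is prime to \<open>p\<close>: otherwise \<open>S\<close> would be a union of cosets outside \<open>p\<int>\<close>.\<close>
  have unit_partner: "False" if ij: "eigenvalue_sum n S i + eigenvalue_sum n S j = - 1"
    and i: "\<not> int p dvd i" and j: "int p dvd j" for i j
  proof -
    obtain k where k: "[i * k = 1] (mod int n)" using inv[OF i] by blast
    have unmult: "(x * i) mod int n * k mod int n = x mod int n" for x
    proof -
      have "[x * (i * k) = x * 1] (mod int n)" using k by (rule cong_scalar_left)
      then show ?thesis by (simp add: cong_def mult.assoc mod_mult_left_eq)
    qed
    have x1: "\<not> int p dvd x1" using x01 cong_dvd_iff by blast
    have nd: "\<not> int p dvd (x0 * i) mod int n" "\<not> int p dvd (x1 * i) mod int n"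
      unfolding dvdp using x01(2) x1 i p by (simp_all add: prime_dvd_mult_iff)
    have "[(x0 * i) mod int n = (x1 * i) mod int n] (mod int p)"
      unfolding cong_def modp using cong_scalar_right[OF x01(1), of i] by (simp add: cong_def)
    from rel[OF ij rng rng this] show False
      unfolding mult_count_unit[OF n(1) S0(1) rng k] unmult
        mult_count_nonunit[OF j n(5) nd(1)] mult_count_nonunit[OF j n(5) nd(2)]
      using x01(3,4) nd n_def by (auto simp: of_bool_def split: if_splits)
  qed
  \<comment> \<open>The multiplier from the partner of \<open>\<lambda>\<^sub>1\<close>, and the relation that it satisfies on each coset.\<close>
  obtain j1 where j1: "j1 \<in> {1..<int n}" "eigenvalue_sum n S 1 + eigenvalue_sum n S j1 = - 1"
    using partner[of 1] p0 less_1_mult[of "int p" "int p"] unfolding n(2) by auto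
  have "\<not> int p dvd j1" using unit_partner[OF j1(2)] p0 by auto
  then obtain \<mu> where \<mu>: "[j1 * \<mu> = 1] (mod int n)" using inv by blast
  have "coprime \<mu> (int n)" using \<mu> by (metis coprime_iff_invertible_int mult.commute)
  then have \<mu>p: "coprime \<mu> (int p)" unfolding n by simp
  then have \<mu>nd: "\<not> int p dvd \<mu>" using coprime_common_divisor[OF \<mu>p, of "int p"] p0 by auto
  have h: "(of_bool (inS x) :: int) + of_bool (inS (x * \<mu>)) + of_bool (int n dvd x)
      = of_bool (inS y) + of_bool (inS (y * \<mu>)) + of_bool (int n dvd y)" if "[x = y] (mod int p)" for x y
  proof -
    have "[x mod int n = y mod int n] (mod int p)" using that by (simp add: cong_def modp)
    from rel[OF j1(2) rng rng this] show ?thesis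
      unfolding mult_count_unit[OF n(1) S0(1) rng \<mu>] mult_count_1[OF n(1) S0(1) rng]
      by (simp add: inS_def mod_mult_left_eq dvd_eq_mod_eq_0)
  qed
  \<comment> \<open>The multiplier from the partner of \<open>\<lambda>\<^sub>p\<close>, which acts on the sizes \<open>a c\<close> of the intersections with the cosets.\<close>
  define a where "a x = int (card {s \<in> S. s mod int p = x mod int p})" for x
  obtain \<nu> where \<nu>: "coprime \<nu> (int p)" and a\<nu>: "\<And>c. \<not> int p dvd c \<Longrightarrow> a c + a (c * \<nu>) = int p"
  proof -
    have "int p \<in> {1..<int n}" using p0 n by simp
    then obtain j where j: "j \<in> {1..<int n}" "eigenvalue_sum n S (int p) + eigenvalue_sum n S j = - 1"
      using partner by blast
    have "int p dvd j" using unit_partner[of j "int p"] j by (auto simp: add.commute)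
    then obtain i where i: "j = int p * i" by blast
    have nd: "\<not> int p dvd i"
    proof
      assume "int p dvd i"
      then have "int n dvd j" unfolding i n by simp
      then show False using j zdvd_imp_le[of "int n" j] by auto
    qed
    have "coprime i (int p)" using prime_imp_coprime[of "int p" i] p nd by (simp add: coprime_commute)
    then obtain k where k: "[i * k = 1] (mod int p)" using cong_solve_coprime_int by blast
    have eq: "eigenvalue_sum p S 1 + eigenvalue_sum p S i = - 1"
      using j(2) eigenvalue_sum_mult_left[OF p0(2), of p S 1] eigenvalue_sum_mult_left[OF p0(2), of p S i]
      unfolding i n(4) by simp
    have m1: "int (mult_count p S 1 c) = a c" if "c \<in> {0..<int p}" for c
      using that by (simp add: mult_count_def a_def)
    have mi: "int (mult_count p S i c) = a (c * k)" if "c \<in> {0..<int p}" for c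
    proof -
      have "(s * i) mod int p = c \<longleftrightarrow> s mod int p = (c * k) mod int p" for s
      proof
        assume "(s * i) mod int p = c"
        then have "[s * i = c] (mod int p)" using that by (simp add: cong_def)
        then have "[s * i * k = c * k] (mod int p)" by (rule cong_scalar_right)
        moreover have "[s * (i * k) = s * 1] (mod int p)" using k by (rule cong_scalar_left)
        ultimately show "s mod int p = (c * k) mod int p" by (simp add: cong_def mult.assoc)
      next
        assume "s mod int p = (c * k) mod int p"
        then have "[s = c * k] (mod int p)" by (simp add: cong_def)
        then have "[s * i = c * k * i] (mod int p)" by (rule cong_scalar_right)
        moreover have "[c * (i * k) = c * 1] (mod int p)" using k by (rule cong_scalar_left)
        ultimately show "(s * i) mod int p = c" using that by (simp add: cong_def mult_ac)
      qed
      then show ?thesis by (simp add: mult_count_def a_def)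
    qed
    \<comment> \<open>The left-hand side of \<open>relK\<close> is constant, and its sum over all cosets is \<open>2 * card S + 1 = p * p\<close>; so \<open>K = p\<close>.\<close>
    define K where "K = a 0 + a 0 + 1"
    have relK: "a c + a (c * k) + of_bool (c = 0) = K" if c: "c \<in> {0..<int p}" for c
    proof -
      have "1 * int (mult_count (p ^ Suc 0) S 1 c) + 1 * int (mult_count (p ^ Suc 0) S i c) + 1 * of_bool (c = 0)
        = 1 * int (mult_count (p ^ Suc 0) S 1 0) + 1 * int (mult_count (p ^ Suc 0) S i 0) + 1 * of_bool ((0::int) = 0)"
        by (rule eigenvalue_relation_coset_constant[OF p(1) fin fin]) (use c p0 eq in simp_all)
      then show ?thesis using m1[OF c] mi[OF c] m1[of 0] mi[of 0] p0 by (simp add: K_def)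
    qed
    have tot: "(\<Sum>c\<in>{0..<int p}. int (mult_count p S l c)) = int (card S)" for l
    proof -
      have "(\<Sum>c\<in>{0..<int p}. card {s \<in> S. (s * l) mod int p = c}) = card S"
      proof -
        have "(\<lambda>s. (s * l) mod int p) ` S \<subseteq> {0..<int p}" using p0 by (intro image_subsetI) simp
        from sum.group[OF fin _ this, of "\<lambda>_. 1::nat"] show ?thesis by simp
      qed
      then show ?thesis by (simp add: mult_count_def flip: of_nat_sum)
    qed
    have "(\<Sum>c\<in>{0..<int p}. a c + a (c * k) + of_bool (c = 0)) = int p * K"
      using relK by simp
    moreover have "(\<Sum>c\<in>{0..<int p}. a c + a (c * k) + of_bool (c = 0))
        = (\<Sum>c\<in>{0..<int p}. int (mult_count p S 1 c)) + (\<Sum>c\<in>{0..<int p}. int (mult_count p S i c))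
          + (\<Sum>c\<in>{0..<int p}. of_bool (c = 0))"
      unfolding sum.distrib[symmetric] by (intro sum.cong) (auto simp: m1 mi)
    moreover have "(\<Sum>c\<in>{0..<int p}. of_bool (c = 0)) = (1 :: int)"
    proof -
      have "(\<Sum>c\<in>{0..<int p}. of_bool (c = 0)) = (\<Sum>c\<in>{0::int}. 1 :: int)"
        by (rule sum.mono_neutral_cong_right) (use p0 in auto)
      then show ?thesis by simp
    qed
    moreover have "2 * int (card S) = int n - 1"
    proof -
      have "card S = card ({1..<int n} - S)" by (rule isomorphic_circ_card[OF n(1) S0 iso])
      moreover have "card ({1..<int n} - S) = card {1..<int n} - card S" using fin S1 by (rule card_Diff_subset)
      moreover have "card S \<le> card {1..<int n}" using S1 by (intro card_mono) auto
      ultimately show ?thesis using n(1) by simp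
    qed
    ultimately have "int p * K = int p * int p" using tot n(2) by auto
    then have K: "K = int p" using p0 by simp
    show ?thesis
    proof (rule that[of k])
      show "coprime k (int p)" using k by (metis coprime_iff_invertible_int mult.commute)
      fix c assume c: "\<not> int p dvd c"
      have am: "a (x mod int p) = a x" for x by (simp add: a_def)
      have "a (c mod int p * k) = a (c * k)" using am[of "c mod int p * k"] am[of "c * k"] by (simp add: mod_mult_left_eq)
      then show "a c + a (c * k) = int p"
        using relK[of "c mod int p"] c p0 am[of c] K by (simp add: dvd_eq_mod_eq_0)
    qed
  qed
  \<comment> \<open>The nonzero residues in \<open>p\<int>\<close> and in the partial cosets: there \<open>\<mu>\<close> exchanges \<open>S\<close> and its complement.\<close>
  define D where "D x \<longleftrightarrow> (int p dvd x \<and> \<not> int n dvd x) \<or> (\<not> int p dvd x \<and> (\<exists>y. [x = y] (mod int p) \<and> inS x \<noteq> inS y))" for x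
  have nzs: "sgn_mod n S x \<noteq> 0" for x by (simp add: sgn_mod_def)
  have sg: "sgn_mod n S x = (if inS x then 1 else - 1)" for x by (simp add: sgn_mod_def inS_def)
  have step: "D (x * \<mu>) \<and> sgn_mod n S (x * \<mu>) = - sgn_mod n S x" if D: "D x" for x
  proof (cases "int p dvd x")
    case True
    then have x: "\<not> int n dvd x" using D by (simp add: D_def)
    have "\<not> int n dvd x * \<mu>"
      using x \<open>coprime \<mu> (int n)\<close> by (metis coprime_commute coprime_dvd_mult_left_iff)
    moreover have "inS x \<noteq> inS (x * \<mu>)"
    proof -
      have "[x = 0] (mod int p)" using True by (simp add: cong_0_iff)
      moreover have "\<not> inS 0" using S1 by (auto simp: inS_def)
      ultimately show ?thesis using h[of x 0] x by (auto simp: of_bool_def split: if_splits)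
    qed
    ultimately show ?thesis using True by (simp add: D_def sg)
  next
    case False
    then obtain y where y: "[x = y] (mod int p)" "inS x \<noteq> inS y" using D by (auto simp: D_def)
    have ynd: "\<not> int p dvd y" using y False cong_dvd_iff by blast
    have nn: "\<not> int n dvd x" "\<not> int n dvd y" using False ynd n(5) dvd_trans by blast+
    have "inS (x * \<mu>) \<noteq> inS x" "inS (y * \<mu>) \<noteq> inS (x * \<mu>)"
      using h[OF y(1)] y(2) nn by (auto simp: of_bool_def split: if_splits)
    moreover have "[x * \<mu> = y * \<mu>] (mod int p)" using y(1) by (rule cong_scalar_right)
    moreover have "\<not> int p dvd x * \<mu>" using False \<mu>nd p by (simp add: prime_dvd_mult_iff)
    ultimately show ?thesis by (auto simp: D_def sg)
  qed
  obtain \<epsilon> where \<epsilon>: "\<epsilon> \<in> {1, - 1}" "\<And>x. D x \<Longrightarrow> sgn_mod n S (- x) = \<epsilon> * sgn_mod n S x"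
    using sign_of_multiplier[of p \<mu> 2 "sgn_mod n S" D, OF p \<mu>p _ step nzs] sgn_mod_cong
    unfolding n_def by blast
  have a_cong: "a x = a y" if "[x = y] (mod int p)" for x y
    using that by (simp add: a_def cong_def)
  obtain \<epsilon>' where \<epsilon>': "\<epsilon>' \<in> {1, - 1}" "\<And>x. \<not> int p dvd x \<Longrightarrow> 2 * a (- x) - int p = \<epsilon>' * (2 * a x - int p)"
  proof (rule sign_of_multiplier[of p \<nu> 1 "\<lambda>x. 2 * a x - int p" "\<lambda>x. \<not> int p dvd x", OF p \<nu>])
    show "2 * a x - int p = 2 * a y - int p" if "[x = y] (mod int (p ^ 1))" for x y
      using a_cong[of x y] that by simp
    show "\<not> int p dvd x * \<nu> \<and> 2 * a (x * \<nu>) - int p = - (2 * a x - int p)" if "\<not> int p dvd x" for x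
      using a\<nu>[OF that] that \<nu> by (auto simp: coprime_dvd_mult_left_iff coprime_commute)
    show "2 * a x - int p \<noteq> 0" for x using p(2) by presburger
  qed (use that in blast)
  have cosum: "(\<Sum>t\<in>{0..<int p}. sgn_mod n S (x + u * (int p * t))) = 2 * a x - int p" if "u \<in> {1, - 1}" for x u
    unfolding n_def a_def by (rule sum_sgn_mod_coset[OF p0(2) _ that]) (use S0 n_def in auto)
  \<comment> \<open>Both signs act on the coset of \<open>x0\<close>, whose sign sum is odd and hence nonzero.\<close>
  have "\<epsilon> = \<epsilon>'"
  proof -
    have Dt: "D (x0 + int p * t)" for t
    proof -
      have "[x0 + int p * t = x0] (mod int p)" "[x0 + int p * t = x1] (mod int p)"
        using x01(1) by (simp_all add: cong_def)
      moreover have "\<not> int p dvd x0 + int p * t" using x01(2) by (subst dvd_add_left_iff) auto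
      moreover have "inS x0 \<noteq> inS x1" using x01 by (simp add: inS_def n_def)
      ultimately show ?thesis unfolding D_def by blast
    qed
    have "2 * a (- x0) - int p = (\<Sum>t\<in>{0..<int p}. sgn_mod n S (- x0 + (- 1) * (int p * t)))"
      by (rule cosum[symmetric]) simp
    also have "\<dots> = (\<Sum>t\<in>{0..<int p}. \<epsilon> * sgn_mod n S (x0 + 1 * (int p * t)))"
      using \<epsilon>(2)[OF Dt] by simp
    also have "\<dots> = \<epsilon> * (2 * a x0 - int p)"
      unfolding sum_distrib_left[symmetric] by (subst cosum) simp_all
    finally have "\<epsilon> * (2 * a x0 - int p) = \<epsilon>' * (2 * a x0 - int p)" using \<epsilon>'(2)[OF x01(2)] by (simp only:)
    moreover have "2 * a x0 - int p \<noteq> 0" using p(2) by presburger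
    ultimately show ?thesis by auto
  qed
  have "sgn_mod n S (- x) = \<epsilon> * sgn_mod n S x" if x: "\<not> int n dvd x" for x
  proof (cases "D x")
    case False
    then have nd: "\<not> int p dvd x" using x by (auto simp: D_def)
    have "sgn_mod n S (x + 1 * (int p * t)) = sgn_mod n S x" for t
    proof -
      have "[x = x + 1 * (int p * t)] (mod int p)" by (simp add: cong_def)
      then have "inS x = inS (x + 1 * (int p * t))" using False nd unfolding D_def by blast
      then show ?thesis by (simp add: sg)
    qed
    then have "2 * a x - int p = int p * sgn_mod n S x" using cosum[of 1 x] by simp
    then have "(\<Sum>t\<in>{0..<int p}. sgn_mod n S (- x + 1 * (int p * t))) = (\<epsilon> * sgn_mod n S x) * int p"
      using cosum[of 1 "- x"] \<epsilon>'(2)[OF nd] \<open>\<epsilon> = \<epsilon>'\<close> by simp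
    moreover have "\<epsilon> * sgn_mod n S x \<in> {1, - 1}" using \<epsilon>(1) by (auto simp: sg)
    ultimately have "sgn_mod n S (- x + 1 * (int p * 0)) = \<epsilon> * sgn_mod n S x"
      using sgn_mod_eq_of_coset_sum[of "\<epsilon> * sgn_mod n S x" n S "\<lambda>t. - x + 1 * (int p * t)" p 0] p0 by simp
    then show ?thesis by simp
  qed (rule \<epsilon>(2))
  then show ?thesis using \<epsilon>(1) unfolding n_def by blast
qed

section \<open>Connection sets and Cayley isomorphism\<close>

lemma circulant_iff_circ:
  assumes n: "n > 0"
  shows "circulant n X \<longleftrightarrow> (\<exists>S\<subseteq>{1..<int n}. X = circ n S)"
proof
  assume X: "circulant n X"
  define c where "c = (\<lambda>v. (v + 1) mod int n)"
  define S where "S = {s \<in> {1..<int n}. (0, s) \<in> parcs X}"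
  have V: "pverts X = {0..<int n}" and inv: "map_prod c c ` parcs X = parcs X" and pd: "pair_digraph X"
    using X by (auto simp: circulant_def c_def Let_def)
  interpret pair_digraph X by (rule pd)
  have arcs: "parcs X \<subseteq> {0..<int n} \<times> {0..<int n}"
    using V wellformed' by auto
  have fin: "finite (parcs X)" by (rule pair_finite_arcs)
  have shift: "(c u, c v) \<in> parcs X \<longleftrightarrow> (u, v) \<in> parcs X"
    if uv: "u \<in> {0..<int n}" "v \<in> {0..<int n}" for u v
  proof
    assume "(u, v) \<in> parcs X"
    then have "map_prod c c (u, v) \<in> map_prod c c ` parcs X" by blast
    then show "(c u, c v) \<in> parcs X" using inv by simp
  next
    assume "(c u, c v) \<in> parcs X"
    then have "(c u, c v) \<in> map_prod c c ` parcs X" using inv by simp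
    then obtain u' v' where a: "(u', v') \<in> parcs X" and e: "c u' = c u" "c v' = c v" by auto
    have inj: "x = y" if "c x = c y" "x \<in> {0..<int n}" "y \<in> {0..<int n}" for x y
    proof -
      have "[x + 1 = y + 1] (mod int n)" using that by (simp add: c_def cong_def)
      then have "[x = y] (mod int n)" by (simp only: cong_add_rcancel)
      then show ?thesis using that by (simp add: cong_def)
    qed
    have "u' = u" "v' = v" using inj e uv a arcs by blast+
    then show "(u, v) \<in> parcs X" using a by simp
  qed
  have shifts: "((u + int k) mod int n, (v + int k) mod int n) \<in> parcs X \<longleftrightarrow> (u, v) \<in> parcs X"
    if uv: "u \<in> {0..<int n}" "v \<in> {0..<int n}" for u v k
  proof (induction k)
    case 0
    then show ?case using uv by simp
  next
    case (Suc k)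
    have "c ((x + int k) mod int n) = (x + int (Suc k)) mod int n" for x
      by (simp add: c_def mod_simps ac_simps)
    then show ?case using shift[of "(u + int k) mod int n" "(v + int k) mod int n"] Suc n by simp
  qed
  have "(u, v) \<in> parcs X \<longleftrightarrow> (u, v) \<in> parcs (circ n S)" for u v
  proof (cases "u \<in> {0..<int n} \<and> v \<in> {0..<int n}")
    case True
    have "(u, v) \<in> parcs X \<longleftrightarrow> (0, (v - u) mod int n) \<in> parcs X"
    proof -
      have "(0 + int (nat u)) mod int n = u" "((v - u) mod int n + int (nat u)) mod int n = v"
        using True by (simp_all add: mod_simps)
      then show ?thesis using shifts[of 0 "(v - u) mod int n" "nat u"] n by simp
    qed
    also have "\<dots> \<longleftrightarrow> (v - u) mod int n \<in> S"
    proof -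
      have "(0, 0) \<notin> parcs X" using no_loops' by blast
      moreover have "0 \<le> (v - u) mod int n" "(v - u) mod int n < int n" using n by simp_all
      ultimately show ?thesis unfolding S_def by (cases "(v - u) mod int n = 0") auto
    qed
    finally show ?thesis using True by simp
  next
    case False
    then show ?thesis using arcs by auto
  qed
  then have "parcs X = parcs (circ n S)" by auto
  then have "X = circ n S" using V by (simp add: circ_def)
  moreover have "S \<subseteq> {1..<int n}" by (auto simp: S_def)
  ultimately show "\<exists>S\<subseteq>{1..<int n}. X = circ n S" by blast
next
  assume "\<exists>S\<subseteq>{1..<int n}. X = circ n S"
  then obtain S where S: "S \<subseteq> {1..<int n}" and X: "X = circ n S" by blast
  define c where "c = (\<lambda>v. (v + 1) mod int n)"
  have sub: "parcs (circ n S) \<subseteq> {0..<int n} \<times> {0..<int n}" by (auto simp: circ_def)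
  have "pair_digraph (circ n S)"
  proof unfold_locales
    show "finite (parcs (circ n S))" using sub finite_subset by blast
    show "fst e \<noteq> snd e" if "e \<in> parcs (circ n S)" for e
      using that S by (auto simp: circ_def)
  qed (auto simp: circ_def)
  moreover have "map_prod c c ` parcs (circ n S) = parcs (circ n S)"
  proof (rule equalityI; rule subsetI)
    fix e assume "e \<in> map_prod c c ` parcs (circ n S)"
    then obtain u v where e: "e = (c u, c v)" "(v - u) mod int n \<in> S" by (auto simp: circ_def)
    have "(c v - c u) mod int n = (v - u) mod int n" by (simp add: c_def mod_simps)
    then show "e \<in> parcs (circ n S)" using e n by (simp add: circ_def c_def)
  next
    fix e assume "e \<in> parcs (circ n S)"
    then obtain u v where e: "e = (u, v)" "u \<in> {0..<int n}" "v \<in> {0..<int n}" "(v - u) mod int n \<in> S"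
      by (auto simp: circ_def)
    define u' v' where "u' = (u - 1) mod int n" and "v' = (v - 1) mod int n"
    have "c u' = u" "c v' = v" using e by (simp_all add: c_def u'_def v'_def mod_simps)
    moreover have "(v' - u') mod int n = (v - u) mod int n" by (simp add: u'_def v'_def mod_simps)
    then have "(u', v') \<in> parcs (circ n S)" using e n by (simp add: u'_def v'_def)
    ultimately show "e \<in> map_prod c c ` parcs (circ n S)" using e by force
  qed
  ultimately show "circulant n X" unfolding circulant_def X c_def Let_def by simp
qed

lemma iso_integer_mod_group_mult:
  assumes n: "n > 0" and \<sigma>: "\<sigma> \<in> iso (integer_mod_group n) (integer_mod_group n)"
  obtains m where "coprime m (int n)" "\<And>x. x \<in> {0..<int n} \<Longrightarrow> \<sigma> x = (x * m) mod int n"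
proof -
  let ?m = "\<sigma> (1 mod int n)"
  have c: "carrier (integer_mod_group n) = {0..<int n}" using n by (simp add: carrier_integer_mod_group)
  have bij: "bij_betw \<sigma> {0..<int n} {0..<int n}" and hom: "\<sigma> \<in> hom (integer_mod_group n) (integer_mod_group n)"
    using \<sigma> by (auto simp: iso_def c)
  have add: "\<sigma> ((x + y) mod int n) = (\<sigma> x + \<sigma> y) mod int n" if "x \<in> {0..<int n}" "y \<in> {0..<int n}" for x y
    using hom_mult[OF hom, of x y] that by (simp add: c)
  have mult: "\<sigma> (int k mod int n) = (int k * ?m) mod int n" for k
  proof (induction k)
    case 0
    have "\<sigma> 0 = (\<sigma> 0 + \<sigma> 0) mod int n" using add[of 0 0] n by simp
    moreover have "\<sigma> 0 \<in> {0..<int n}" using bij n by (auto simp: bij_betw_def)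
    ultimately have "[\<sigma> 0 + 0 = \<sigma> 0 + \<sigma> 0] (mod int n)" by (simp add: cong_def)
    then have "[0 = \<sigma> 0] (mod int n)" by (simp only: cong_add_lcancel)
    then show ?case using \<open>\<sigma> 0 \<in> _\<close> by (simp add: cong_def)
  next
    case (Suc k)
    have "\<sigma> (int (Suc k) mod int n) = \<sigma> ((int k mod int n + 1 mod int n) mod int n)"
      by (simp add: mod_add_eq add.commute)
    also have "\<dots> = ((int k * ?m) mod int n + ?m) mod int n"
      using n by (subst add) (simp_all add: Suc)
    also have "\<dots> = (int (Suc k) * ?m) mod int n"
      by (simp add: mod_add_left_eq mod_add_right_eq distrib_right add.commute)
    finally show ?case .
  qed
  have 1: "\<sigma> x = (x * ?m) mod int n" if "x \<in> {0..<int n}" for x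
    using mult[of "nat x"] that by simp
  have "1 mod int n \<in> \<sigma> ` {0..<int n}" using bij n by (simp add: bij_betw_def)
  then obtain x where "1 mod int n = \<sigma> x" "x \<in> {0..<int n}" by (rule imageE)
  then have "[x * ?m = 1] (mod int n)" using 1[of x] by (simp add: cong_def)
  then have "[?m * x = 1] (mod int n)" by (simp add: mult.commute)
  then have "coprime ?m (int n)" using coprime_iff_invertible_int by blast
  then show ?thesis using 1 that by blast
qed

lemma Cayley_isomorphic_circ:
  assumes n: "n > 0" and "Cayley_isomorphic n (circ n S) (circ n T)"
  shows "mult_equiv n S T"
proof -
  obtain \<sigma> where \<sigma>: "\<sigma> \<in> iso (integer_mod_group n) (integer_mod_group n)"
    and arcs: "parcs (circ n T) = map_prod \<sigma> \<sigma> ` parcs (circ n S)"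
    using assms(2) by (auto simp: Cayley_isomorphic_def)
  obtain m where m: "coprime m (int n)" and e: "\<And>x. x \<in> {0..<int n} \<Longrightarrow> \<sigma> x = (x * m) mod int n"
    using iso_integer_mod_group_mult[OF n \<sigma>] by blast
  have inj: "inj_on \<sigma> {0..<int n}"
    using bij_mult_mod[OF n m] inj_on_cong[of "{0..<int n}" \<sigma> "\<lambda>u. (u * m) mod int n", OF e]
    by (simp add: bij_betw_def)
  have "x mod int n \<in> S \<longleftrightarrow> (x * m) mod int n \<in> T" for x
  proof -
    let ?x = "x mod int n"
    have r: "?x \<in> {0..<int n}" "0 \<in> {0..<int n}" using n by simp_all
    have \<sigma>0: "\<sigma> 0 = 0" "\<sigma> ?x = (x * m) mod int n" using e[OF r(2)] e[OF r(1)] by (simp_all add: mod_mult_left_eq)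
    have "?x \<in> S \<longleftrightarrow> (0, ?x) \<in> parcs (circ n S)" using r by simp
    also have "\<dots> \<longleftrightarrow> (\<sigma> 0, \<sigma> ?x) \<in> parcs (circ n T)"
    proof
      assume "(0, ?x) \<in> parcs (circ n S)"
      then have "map_prod \<sigma> \<sigma> (0, ?x) \<in> map_prod \<sigma> \<sigma> ` parcs (circ n S)" by (rule imageI)
      then show "(\<sigma> 0, \<sigma> ?x) \<in> parcs (circ n T)" unfolding arcs by simp
    next
      assume "(\<sigma> 0, \<sigma> ?x) \<in> parcs (circ n T)"
      then have "(\<sigma> 0, \<sigma> ?x) \<in> map_prod \<sigma> \<sigma> ` parcs (circ n S)" unfolding arcs .
      then obtain a b where ab: "(a, b) \<in> parcs (circ n S)" "\<sigma> a = \<sigma> 0" "\<sigma> b = \<sigma> ?x" by auto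
      then have "a \<in> {0..<int n}" "b \<in> {0..<int n}" by simp_all
      then have "a = 0" "b = ?x" using ab(2,3) inj r by (auto dest: inj_onD)
      then show "(0, ?x) \<in> parcs (circ n S)" using ab(1) by simp
    qed
    also have "\<dots> \<longleftrightarrow> (x * m) mod int n \<in> T" unfolding \<sigma>0 using n by simp
    finally show ?thesis .
  qed
  then show ?thesis using m unfolding mult_equiv_def by blast
qed

lemma mult_equiv_complement_of_tournament:
  assumes n: "n > 0" and S: "S \<subseteq> {1..<int n}" and t: "tournament (circ n S)"
  shows "mult_equiv n S ({1..<int n} - S)"
proof -
  have "x mod int n \<in> S \<longleftrightarrow> (x * (- 1)) mod int n \<in> {1..<int n} - S" for x
  proof (cases "int n dvd x")
    case True
    then have "x mod int n = 0" "(- x) mod int n = 0" by (simp_all flip: dvd_eq_mod_eq_0)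
    then show ?thesis using S by auto
  next
    case False
    then have "sgn_mod n S (- x) = - sgn_mod n S x" using t tournament_circ_iff[OF n S] by blast
    moreover have "(- x) mod int n \<in> {1..<int n}" using False by (intro mod_in_nonzero_residues[OF n]) simp
    ultimately show ?thesis by (auto simp: sgn_mod_def split: if_splits)
  qed
  moreover have "coprime (- 1) (int n)" by simp
  ultimately show ?thesis unfolding mult_equiv_def by blast
qed

lemma self_complementary_circ_iff:
  assumes "n > 0" "S \<subseteq> {1..<int n}"
  shows "self_complementary (circ n S) \<longleftrightarrow> isomorphic (circ n S) (circ n ({1..<int n} - S))"
  unfolding self_complementary_def complement_circ[OF assms] ..

lemma not_undirected_and_tournament:
  assumes n: "n > 1" and S: "S \<subseteq> {1..<int n}"
  shows "\<not> (undirected (circ n S) \<and> tournament (circ n S))"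
proof
  assume a: "undirected (circ n S) \<and> tournament (circ n S)"
  have "\<not> int n dvd 1" using n by auto
  then have "sgn_mod n S (- 1) = sgn_mod n S 1" "sgn_mod n S (- 1) = - sgn_mod n S 1"
    using a undirected_circ_iff[OF _ S] tournament_circ_iff[OF _ S] n by auto
  then show False by (simp add: sgn_mod_def split: if_splits)
qed

section \<open>Mixed self-complementary circulants\<close>

lemma mod_mem_wreath_iff:
  assumes p: "p > 0" and A: "A \<subseteq> {1..<int p}" and B: "B \<subseteq> {1..<int p}"
  shows "x mod int (p\<^sup>2) \<in> wreath p A B \<longleftrightarrow> (if int p dvd x then (x div int p) mod int p \<in> B else x mod int p \<in> A)"
proof -
  define y where "y = x mod int (p\<^sup>2)"
  have y: "y = int p * ((x div int p) mod int p) + x mod int p"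
    using zmod_zmult2_eq[of "int p" x "int p"] by (simp add: y_def power2_eq_square)
  have ymod: "y mod int p = x mod int p" and ydiv: "y div int p = (x div int p) mod int p"
    using p unfolding y by simp_all
  have ydvd: "int p dvd y \<longleftrightarrow> int p dvd x" using ymod by (simp add: dvd_eq_mod_eq_0)
  have "0 \<le> y" "y < int p ^ 2" using p by (simp_all add: y_def)
  moreover have "y \<noteq> 0" if "if int p dvd y then y div int p \<in> B else y mod int p \<in> A"
    using that A B by (auto split: if_splits)
  ultimately have "y \<in> wreath p A B \<longleftrightarrow> (if int p dvd y then y div int p \<in> B else y mod int p \<in> A)"
    unfolding wreath_def by fastforce
  then show ?thesis unfolding ydvd ymod ydiv unfolding y_def .
qed

lemma diff_mod_mem_wreath_iff:
  assumes p: "p > 0" and A: "A \<subseteq> {1..<int p}" and B: "B \<subseteq> {1..<int p}"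
  shows "(v - u) mod int (p\<^sup>2) \<in> wreath p A B \<longleftrightarrow>
    (if u mod int p = v mod int p then (v div int p - u div int p) mod int p \<in> B
     else (v mod int p - u mod int p) mod int p \<in> A)"
proof -
  have d: "int p dvd v - u \<longleftrightarrow> u mod int p = v mod int p"
    by (metis mod_eq_dvd_iff)
  have "(v - u) div int p = v div int p - u div int p" if "u mod int p = v mod int p"
  proof -
    have diff: "V - U = q * (b - a)" if "U = q * a + r" "V = q * b + r" for U V q a b r :: int
      using that by (simp add: algebra_simps)
    have "u = int p * (u div int p) + u mod int p" by (rule mult_div_mod_eq[symmetric])
    moreover have "v = int p * (v div int p) + u mod int p"
      unfolding that by (rule mult_div_mod_eq[symmetric])
    ultimately have "v - u = int p * (v div int p - u div int p)" by (rule diff)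
    then show ?thesis using p by (metis nonzero_mult_div_cancel_left of_nat_0_less_iff less_irrefl)
  qed
  then show ?thesis unfolding mod_mem_wreath_iff[OF assms] d by (simp add: mod_diff_eq)
qed

lemma isomorphic_wreath:
  assumes p: "p > 0" and A: "A \<subseteq> {1..<int p}" and B: "B \<subseteq> {1..<int p}"
    and A': "A' \<subseteq> {1..<int p}" and B': "B' \<subseteq> {1..<int p}"
    and isoA: "isomorphic (circ p A) (circ p A')" and isoB: "isomorphic (circ p B) (circ p B')"
  shows "isomorphic (circ (p\<^sup>2) (wreath p A B)) (circ (p\<^sup>2) (wreath p A' B'))"
proof -
  obtain f where f: "bij_betw f {0..<int p} {0..<int p}"
    and fA: "\<And>u v. u \<in> {0..<int p} \<Longrightarrow> v \<in> {0..<int p} \<Longrightarrow> (v - u) mod int p \<in> A \<longleftrightarrow> (f v - f u) mod int p \<in> A'"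
    using isoA unfolding isomorphic_circ_iff by blast
  obtain g where g: "bij_betw g {0..<int p} {0..<int p}"
    and gB: "\<And>u v. u \<in> {0..<int p} \<Longrightarrow> v \<in> {0..<int p} \<Longrightarrow> (v - u) mod int p \<in> B \<longleftrightarrow> (g v - g u) mod int p \<in> B'"
    using isoB unfolding isomorphic_circ_iff by blast
  have fr: "f x \<in> {0..<int p}" if "x \<in> {0..<int p}" for x using f that bij_betwE by blast
  have gr: "g x \<in> {0..<int p}" if "x \<in> {0..<int p}" for x using g that bij_betwE by blast
  have finj: "f x = f y \<longleftrightarrow> x = y" if "x \<in> {0..<int p}" "y \<in> {0..<int p}" for x y
    using f that by (auto simp: bij_betw_def dest: inj_onD)
  have ginj: "g x = g y \<longleftrightarrow> x = y" if "x \<in> {0..<int p}" "y \<in> {0..<int p}" for x y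
    using g that by (auto simp: bij_betw_def dest: inj_onD)
  define \<phi> where "\<phi> u = f (u mod int p) + int p * g (u div int p)" for u
  have n: "int (p\<^sup>2) = int p * int p" by (simp add: power2_eq_square)
  have um: "u mod int p \<in> {0..<int p}" for u using p by simp
  have ud: "u div int p \<in> {0..<int p}" if "u \<in> {0..<int (p\<^sup>2)}" for u
  proof -
    have "0 \<le> u div int p" using that p by (simp add: pos_imp_zdiv_nonneg_iff)
    moreover have "\<not> int p \<le> u div int p"
    proof
      assume "int p \<le> u div int p"
      then have "int p * int p \<le> int p * (u div int p)" by (intro mult_left_mono) simp_all
      also have "\<dots> \<le> u" using p by (simp add: minus_mod_eq_mult_div[symmetric])
      finally show False using that unfolding n by simp
    qed
    ultimately show ?thesis by simp
  qed
  have \<phi>m: "\<phi> u mod int p = f (u mod int p)" for u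
    using fr[OF um] by (simp add: \<phi>_def)
  have \<phi>d: "\<phi> u div int p = g (u div int p)" for u
    using fr[OF um, of u] p by (simp add: \<phi>_def)
  have \<phi>r: "\<phi> u \<in> {0..<int (p\<^sup>2)}" if u: "u \<in> {0..<int (p\<^sup>2)}" for u
  proof -
    have f1: "0 \<le> f (u mod int p)" "f (u mod int p) < int p" using fr[OF um, of u] by simp_all
    have g1: "0 \<le> g (u div int p)" "g (u div int p) + 1 \<le> int p" using gr[OF ud[OF u]] by simp_all
    have "int p * (g (u div int p) + 1) \<le> int p * int p" by (rule mult_left_mono) (use g1 in simp_all)
    then have "\<phi> u < int p * int p" using f1 by (simp add: \<phi>_def distrib_left)
    moreover have "0 \<le> \<phi> u" using f1 g1 by (simp add: \<phi>_def)
    ultimately show ?thesis unfolding n by simp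
  qed
  have "inj_on \<phi> {0..<int (p\<^sup>2)}"
  proof (rule inj_onI)
    fix u v assume u: "u \<in> {0..<int (p\<^sup>2)}" and v: "v \<in> {0..<int (p\<^sup>2)}" and e: "\<phi> u = \<phi> v"
    have "u mod int p = v mod int p" using e \<phi>m[of u] \<phi>m[of v] finj[OF um um] by metis
    moreover have "u div int p = v div int p" using e \<phi>d[of u] \<phi>d[of v] ginj[OF ud[OF u] ud[OF v]] by metis
    ultimately show "u = v" by (metis div_mult_mod_eq)
  qed
  moreover have "\<phi> ` {0..<int (p\<^sup>2)} \<subseteq> {0..<int (p\<^sup>2)}" using \<phi>r by (rule image_subsetI)
  ultimately have bij: "bij_betw \<phi> {0..<int (p\<^sup>2)} {0..<int (p\<^sup>2)}"
    unfolding bij_betw_def by (metis endo_inj_surj finite_atLeastLessThan_int)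
  have "(v - u) mod int (p\<^sup>2) \<in> wreath p A B \<longleftrightarrow> (\<phi> v - \<phi> u) mod int (p\<^sup>2) \<in> wreath p A' B'"
    if u: "u \<in> {0..<int (p\<^sup>2)}" and v: "v \<in> {0..<int (p\<^sup>2)}" for u v
    unfolding diff_mod_mem_wreath_iff[OF p A B] diff_mod_mem_wreath_iff[OF p A' B'] \<phi>m \<phi>d
      finj[OF um um] fA[OF um um] gB[OF ud[OF u] ud[OF v]] ..
  then show ?thesis unfolding isomorphic_circ_iff using bij by blast
qed

lemma sgn_mod_wreath:
  assumes "p > 0" "A \<subseteq> {1..<int p}" "B \<subseteq> {1..<int p}"
  shows "sgn_mod (p\<^sup>2) (wreath p A B) x = (if int p dvd x then sgn_mod p B (x div int p) else sgn_mod p A x)"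
  unfolding sgn_mod_def mod_mem_wreath_iff[OF assms] by simp

text \<open>
For \<open>\<epsilon> = 1\<close> this compares undirectedness, for \<open>\<epsilon> = -1\<close> the tournament property, of a wreath product
and its factors.
\<close>

lemma sign_symmetric_wreath_iff:
  assumes p: "p > 0" and A: "A \<subseteq> {1..<int p}" and B: "B \<subseteq> {1..<int p}"
  shows "(\<forall>x. \<not> int (p\<^sup>2) dvd x \<longrightarrow> sgn_mod (p\<^sup>2) (wreath p A B) (- x) = \<epsilon> * sgn_mod (p\<^sup>2) (wreath p A B) x)
    \<longleftrightarrow> (\<forall>x. \<not> int p dvd x \<longrightarrow> sgn_mod p A (- x) = \<epsilon> * sgn_mod p A x) \<and>
        (\<forall>x. \<not> int p dvd x \<longrightarrow> sgn_mod p B (- x) = \<epsilon> * sgn_mod p B x)" (is "?L \<longleftrightarrow> ?A \<and> ?B")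
proof (intro iffI conjI allI impI)
  have n: "int (p\<^sup>2) = int p * int p" by (simp add: power2_eq_square)
  have neg: "(- (int p * y)) div int p = - y" for y
    using p nonzero_mult_div_cancel_left[of "int p" "- y"] by simp
  {
    fix x assume L: ?L and x: "\<not> int p dvd x"
    have "\<not> int (p\<^sup>2) dvd x" using x unfolding n by (meson dvd_mult_left)
    then show "sgn_mod p A (- x) = \<epsilon> * sgn_mod p A x"
      using L x unfolding sgn_mod_wreath[OF assms] by (metis dvd_minus_iff)
  next
    fix x assume L: ?L and x: "\<not> int p dvd x"
    have "\<not> int (p\<^sup>2) dvd int p * x" using x p unfolding n by simp
    then have "sgn_mod (p\<^sup>2) (wreath p A B) (- (int p * x)) = \<epsilon> * sgn_mod (p\<^sup>2) (wreath p A B) (int p * x)"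
      using L by blast
    then show "sgn_mod p B (- x) = \<epsilon> * sgn_mod p B x"
      using p unfolding sgn_mod_wreath[OF assms] neg by simp
  next
    fix x assume R: "?A \<and> ?B" and x: "\<not> int (p\<^sup>2) dvd x"
    show "sgn_mod (p\<^sup>2) (wreath p A B) (- x) = \<epsilon> * sgn_mod (p\<^sup>2) (wreath p A B) x"
    proof (cases "int p dvd x")
      case True
      then obtain y where y: "x = int p * y" by blast
      then have "\<not> int p dvd y" using x p unfolding n by simp
      then show ?thesis using R p unfolding sgn_mod_wreath[OF assms] y neg by simp
    next
      case False
      then show ?thesis using R unfolding sgn_mod_wreath[OF assms] by simp
    qed
  }
qed

lemma undirected_wreath_iff:
  assumes p: "p > 0" and A: "A \<subseteq> {1..<int p}" and B: "B \<subseteq> {1..<int p}"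
  shows "undirected (circ (p\<^sup>2) (wreath p A B)) \<longleftrightarrow> undirected (circ p A) \<and> undirected (circ p B)"
proof -
  have n: "p\<^sup>2 > 0" using p by simp
  show ?thesis
    unfolding undirected_circ_iff[OF n wreath_subset] undirected_circ_iff[OF p A] undirected_circ_iff[OF p B]
    using sign_symmetric_wreath_iff[OF assms, of 1] by (simp only: mult_1)
qed

lemma tournament_wreath_iff:
  assumes p: "p > 0" and A: "A \<subseteq> {1..<int p}" and B: "B \<subseteq> {1..<int p}"
  shows "tournament (circ (p\<^sup>2) (wreath p A B)) \<longleftrightarrow> tournament (circ p A) \<and> tournament (circ p B)"
proof -
  have n: "p\<^sup>2 > 0" using p by simp
  show ?thesis
    unfolding tournament_circ_iff[OF n wreath_subset] tournament_circ_iff[OF p A] tournament_circ_iff[OF p B]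
    using sign_symmetric_wreath_iff[OF assms, of "- 1"] by (simp only: mult_minus1)
qed

lemma complement_wreath:
  assumes p: "p > 0" and A: "A \<subseteq> {1..<int p}" and B: "B \<subseteq> {1..<int p}"
  shows "{1..<int (p\<^sup>2)} - wreath p A B = wreath p ({1..<int p} - A) ({1..<int p} - B)"
proof (rule Set.set_eqI)
  fix x
  have n: "p\<^sup>2 > 0" using p by simp
  show "x \<in> {1..<int (p\<^sup>2)} - wreath p A B \<longleftrightarrow> x \<in> wreath p ({1..<int p} - A) ({1..<int p} - B)"
  proof (cases "x \<in> {1..<int (p\<^sup>2)}")
    case True
    have x: "x mod int (p\<^sup>2) = x" using True by simp
    have nd: "\<not> int (p\<^sup>2) dvd x" using True zdvd_imp_le[of "int (p\<^sup>2)" x] by auto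
    have "(x div int p) mod int p \<in> {1..<int p}" if "int p dvd x"
    proof (rule mod_in_nonzero_residues[OF p])
      show "\<not> int p dvd x div int p"
      proof
        assume "int p dvd x div int p"
        then have "int p * int p dvd int p * (x div int p)" by (rule mult_dvd_mono[OF dvd_refl])
        then show False using nd that by (simp add: power2_eq_square)
      qed
    qed
    moreover have "x mod int p \<in> {1..<int p}" if "\<not> int p dvd x"
      using that by (rule mod_in_nonzero_residues[OF p])
    moreover have "x \<in> wreath p A B \<longleftrightarrow> (if int p dvd x then (x div int p) mod int p \<in> B else x mod int p \<in> A)"
      using mod_mem_wreath_iff[OF assms, of x] unfolding x .
    moreover have "x \<in> wreath p ({1..<int p} - A) ({1..<int p} - B) \<longleftrightarrow>
        (if int p dvd x then (x div int p) mod int p \<in> {1..<int p} - B else x mod int p \<in> {1..<int p} - A)"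
      using mod_mem_wreath_iff[OF p Diff_subset Diff_subset, of x] unfolding x .
    ultimately show ?thesis using True by (cases "int p dvd x") simp_all
  next
    case False
    then show ?thesis using wreath_subset by blast
  qed
qed

lemma wreath_of_coset_closed:
  assumes p: "p > 0" and S: "S \<subseteq> {1..<int (p\<^sup>2)}"
    and closed: "\<And>x y. [x = y] (mod int p) \<Longrightarrow> \<not> int p dvd x \<Longrightarrow> x mod int (p\<^sup>2) \<in> S \<Longrightarrow> y mod int (p\<^sup>2) \<in> S"
  shows "S = wreath p {a \<in> {1..<int p}. a \<in> S} {b \<in> {1..<int p}. int p * b \<in> S}"
    (is "S = wreath p ?A ?B")
proof (rule Set.set_eqI)
  fix x
  have AB: "?A \<subseteq> {1..<int p}" "?B \<subseteq> {1..<int p}" by auto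
  show "x \<in> S \<longleftrightarrow> x \<in> wreath p ?A ?B"
  proof (cases "x \<in> {1..<int (p\<^sup>2)}")
    case True
    then have x: "x mod int (p\<^sup>2) = x" by simp
    have mem: "x \<in> wreath p ?A ?B \<longleftrightarrow> (if int p dvd x then (x div int p) mod int p \<in> ?B else x mod int p \<in> ?A)"
      using mod_mem_wreath_iff[OF p AB, of x] unfolding x .
    show ?thesis
    proof (cases "int p dvd x")
      case True
      then obtain y where y: "x = int p * y" by blast
      have "0 < int p * y" "int p * y < int p * int p"
        using \<open>x \<in> {1..<int (p\<^sup>2)}\<close> unfolding y by (simp_all add: power2_eq_square)
      then have "y \<in> {1..<int p}" using p by (auto simp: zero_less_mult_iff)
      then show ?thesis unfolding mem using True p unfolding y by simp
    next
      case False
      have r: "x mod int p \<in> {1..<int p}" using False by (rule mod_in_nonzero_residues[OF p])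
      moreover have "int p * 1 \<le> int p * int p" by (rule mult_left_mono) (use p in simp_all)
      ultimately have "x mod int p < int (p\<^sup>2)"
        unfolding power2_eq_square of_nat_mult atLeastLessThan_iff by linarith
      then have rm: "(x mod int p) mod int (p\<^sup>2) = x mod int p" using r by simp
      have "x \<in> S \<longleftrightarrow> x mod int p \<in> S"
      proof
        assume "x \<in> S"
        then show "x mod int p \<in> S"
          using closed[of x "x mod int p"] False unfolding x rm by (simp add: cong_def)
      next
        assume "x mod int p \<in> S"
        then show "x \<in> S"
          using closed[of "x mod int p" x] False unfolding x rm by (simp add: cong_def dvd_mod_iff)
      qed
      then show ?thesis unfolding mem using False r by simp
    qed
  next
    case False
    then show ?thesis using S wreath_subset by blast
  qed
qed

lemma mixed_sd_circulants_wreath: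
  assumes p: "prime p" "odd p" and X: "X \<in> mixed_sd_circulants (p\<^sup>2)"
  obtains A B where "A \<subseteq> {1..<int p}" "B \<subseteq> {1..<int p}" "X = circ (p\<^sup>2) (wreath p A B)"
    "circ p A \<in> su_circulants p \<and> circ p B \<in> t_circulants p \<or> circ p A \<in> t_circulants p \<and> circ p B \<in> su_circulants p"
proof -
  have p0: "p > 0" "p\<^sup>2 > 0" using p by (auto simp: prime_gt_0_nat)
  obtain S where S: "S \<subseteq> {1..<int (p\<^sup>2)}" and XS: "X = circ (p\<^sup>2) S"
    using X circulant_iff_circ[OF p0(2)] by (auto simp: mixed_sd_circulants_def sd_circulants_def)
  have iso: "isomorphic (circ (p\<^sup>2) S) (circ (p\<^sup>2) ({1..<int (p\<^sup>2)} - S))"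
    and nu: "\<not> undirected (circ (p\<^sup>2) S)" and nt: "\<not> tournament (circ (p\<^sup>2) S)"
    using X self_complementary_circ_iff[OF p0(2) S]
    by (auto simp: mixed_sd_circulants_def sd_circulants_def XS)
  have closed: "y mod int (p\<^sup>2) \<in> S"
    if xy: "[x = y] (mod int p)" "\<not> int p dvd x" "x mod int (p\<^sup>2) \<in> S" for x y
  proof (rule ccontr)
    assume "y mod int (p\<^sup>2) \<notin> S"
    then obtain \<epsilon> where "\<epsilon> \<in> {1, - 1}"
      and \<epsilon>: "\<forall>x. \<not> int (p\<^sup>2) dvd x \<longrightarrow> sgn_mod (p\<^sup>2) S (- x) = \<epsilon> * sgn_mod (p\<^sup>2) S x"
      using self_complementary_sign_if_not_coset_closed[OF p S iso xy] by blast
    then consider "\<epsilon> = 1" | "\<epsilon> = - 1" by blast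
    then show False
    proof cases
      case 1
      then show ?thesis using \<epsilon> nu unfolding undirected_circ_iff[OF p0(2) S] by (simp only: mult_1)
    next
      case 2
      then show ?thesis using \<epsilon> nt unfolding tournament_circ_iff[OF p0(2) S] by (simp only: mult_minus1)
    qed
  qed
  define A B where "A = {a \<in> {1..<int p}. a \<in> S}" and "B = {b \<in> {1..<int p}. int p * b \<in> S}"
  have A: "A \<subseteq> {1..<int p}" and B: "B \<subseteq> {1..<int p}" by (auto simp: A_def B_def)
  have SW: "S = wreath p A B" unfolding A_def B_def by (rule wreath_of_coset_closed[OF p0(1) S closed])
  have D: "{1..<int p} - A \<subseteq> {1..<int p}" "{1..<int p} - B \<subseteq> {1..<int p}" by auto
  have "isomorphic (circ (p\<^sup>2) (wreath p A B)) (circ (p\<^sup>2) (wreath p ({1..<int p} - A) ({1..<int p} - B)))"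
    using iso unfolding SW complement_wreath[OF p0(1) A B] .
  note me = isomorphic_wreath_imp_mult_equiv[OF p A B D this]
  have scA: "self_complementary (circ p A)" and scB: "self_complementary (circ p B)"
    using mult_equiv_imp_isomorphic[OF p0(1)] me self_complementary_circ_iff[OF p0(1)] A B by blast+
  have kA: "undirected (circ p A) \<or> tournament (circ p A)" and kB: "undirected (circ p B) \<or> tournament (circ p B)"
    using mult_equiv_complement_imp[OF p, of 1] A B me by simp_all
  have circA: "circulant p (circ p A)" and circB: "circulant p (circ p B)"
    using circulant_iff_circ[OF p0(1)] A B by blast+
  have "\<not> (undirected (circ p A) \<and> undirected (circ p B))" "\<not> (tournament (circ p A) \<and> tournament (circ p B))"
    using nu nt undirected_wreath_iff[OF p0(1) A B] tournament_wreath_iff[OF p0(1) A B] unfolding SW by blast+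
  then have "circ p A \<in> su_circulants p \<and> circ p B \<in> t_circulants p \<or> circ p A \<in> t_circulants p \<and> circ p B \<in> su_circulants p"
    using kA kB scA scB circA circB unfolding su_circulants_def t_circulants_def by blast
  then show ?thesis using that[OF A B] XS SW by blast
qed

lemma t_circulants_self_complementary:
  assumes n: "n > 0" and "X \<in> t_circulants n"
  shows "self_complementary X"
proof -
  obtain S where S: "S \<subseteq> {1..<int n}" "X = circ n S"
    using assms circulant_iff_circ[OF n] by (auto simp: t_circulants_def)
  then have "mult_equiv n S ({1..<int n} - S)"
    using mult_equiv_complement_of_tournament[OF n] assms(2) by (auto simp: t_circulants_def)
  then show ?thesis
    using mult_equiv_imp_isomorphic[OF n] self_complementary_circ_iff[OF n] S by blast
qed

lemma wreath_in_mixed_sd_circulants: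
  assumes p: "p > 1" and A: "A \<subseteq> {1..<int p}" and B: "B \<subseteq> {1..<int p}"
    and AB: "circ p A \<in> su_circulants p \<and> circ p B \<in> t_circulants p \<or> circ p A \<in> t_circulants p \<and> circ p B \<in> su_circulants p"
  shows "circ (p\<^sup>2) (wreath p A B) \<in> mixed_sd_circulants (p\<^sup>2)"
proof -
  have p0: "p > 0" "p\<^sup>2 > 0" using p by auto
  have sc: "self_complementary (circ p A)" "self_complementary (circ p B)"
    using AB t_circulants_self_complementary[OF p0(1)] by (auto simp: su_circulants_def)
  have D: "{1..<int p} - A \<subseteq> {1..<int p}" "{1..<int p} - B \<subseteq> {1..<int p}" by auto
  have "isomorphic (circ p A) (circ p ({1..<int p} - A))" "isomorphic (circ p B) (circ p ({1..<int p} - B))"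
    using sc self_complementary_circ_iff[OF p0(1)] A B by blast+
  then have "self_complementary (circ (p\<^sup>2) (wreath p A B))"
    unfolding self_complementary_circ_iff[OF p0(2) wreath_subset] complement_wreath[OF p0(1) A B]
    by (rule isomorphic_wreath[OF p0(1) A B D])
  moreover have "circulant (p\<^sup>2) (circ (p\<^sup>2) (wreath p A B))"
    using circulant_iff_circ[OF p0(2)] wreath_subset by blast
  moreover have "\<not> undirected (circ (p\<^sup>2) (wreath p A B))" "\<not> tournament (circ (p\<^sup>2) (wreath p A B))"
    unfolding undirected_wreath_iff[OF p0(1) A B] tournament_wreath_iff[OF p0(1) A B]
    using AB not_undirected_and_tournament[OF p A] not_undirected_and_tournament[OF p B]
    by (auto simp: su_circulants_def t_circulants_def)
  ultimately show ?thesis by (simp add: mixed_sd_circulants_def sd_circulants_def)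
qed

text \<open>
The complement is the witness: a multiplier that carries the circulant to its complement would make
it undirected or a tournament.
\<close>

lemma mixed_sd_circulant_non_CI:
  assumes p: "prime p" "odd p" and X: "X \<in> mixed_sd_circulants (p ^ r)" and r: "r > 0"
  shows "non_CI (p ^ r) X"
proof -
  have n: "p ^ r > 0" using p by (simp add: prime_gt_0_nat)
  obtain S where S: "S \<subseteq> {1..<int (p ^ r)}" and XS: "X = circ (p ^ r) S"
    using X circulant_iff_circ[OF n] by (auto simp: mixed_sd_circulants_def sd_circulants_def)
  have iso: "isomorphic X (complement X)" and nu: "\<not> undirected X" "\<not> tournament X" and c: "circulant (p ^ r) X"
    using X by (auto simp: mixed_sd_circulants_def sd_circulants_def self_complementary_def)
  have C: "complement X = circ (p ^ r) ({1..<int (p ^ r)} - S)"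
    unfolding XS by (rule complement_circ[OF n S])
  have "circulant (p ^ r) (complement X)"
    unfolding C using circulant_iff_circ[OF n] by blast
  moreover have "\<not> Cayley_isomorphic (p ^ r) X (complement X)"
    using Cayley_isomorphic_circ[OF n] mult_equiv_complement_imp[OF p r S] nu unfolding C unfolding XS by blast
  ultimately show ?thesis using c iso unfolding non_CI_def by blast
qed

section \<open>Counting isomorphism classes\<close>

text \<open>
The classes among all digraphs, unlike those relative to a family of digraphs, can be compared
between different families.
\<close>

definition iso_class :: "int pair_pre_digraph \<Rightarrow> int pair_pre_digraph set" where
  "iso_class X = {Y. pair_wf_digraph Y \<and> isomorphic X Y}"

lemma isomorphic_refl: "pair_wf_digraph X \<Longrightarrow> isomorphic X X"
  by (subst isomorphic_iff) (auto intro!: exI[of _ id])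

lemma isomorphic_sym:
  assumes "pair_wf_digraph X" "pair_wf_digraph Y" "isomorphic X Y"
  shows "isomorphic Y X"
proof -
  obtain f where f: "bij_betw f (pverts X) (pverts Y)"
    and E: "\<And>u v. u \<in> pverts X \<Longrightarrow> v \<in> pverts X \<Longrightarrow> (u, v) \<in> parcs X \<longleftrightarrow> (f u, f v) \<in> parcs Y"
    using assms(3) unfolding isomorphic_iff[OF assms(1,2)] by blast
  let ?g = "inv_into (pverts X) f"
  have g: "bij_betw ?g (pverts Y) (pverts X)" using f by (rule bij_betw_inv_into)
  have "(u, v) \<in> parcs Y \<longleftrightarrow> (?g u, ?g v) \<in> parcs X" if uv: "u \<in> pverts Y" "v \<in> pverts Y" for u v
  proof -
    have "?g u \<in> pverts X" "?g v \<in> pverts X" using g uv bij_betwE by blast+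
    moreover have "f (?g u) = u" "f (?g v) = v" using f uv by (simp_all add: bij_betw_inv_into_right)
    ultimately show ?thesis using E[of "?g u" "?g v"] by simp
  qed
  then show ?thesis unfolding isomorphic_iff[OF assms(2,1)] using g by blast
qed

lemma isomorphic_trans:
  assumes "pair_wf_digraph X" "pair_wf_digraph Y" "pair_wf_digraph Z" "isomorphic X Y" "isomorphic Y Z"
  shows "isomorphic X Z"
proof -
  obtain f where f: "bij_betw f (pverts X) (pverts Y)"
    and E: "\<And>u v. u \<in> pverts X \<Longrightarrow> v \<in> pverts X \<Longrightarrow> (u, v) \<in> parcs X \<longleftrightarrow> (f u, f v) \<in> parcs Y"
    using assms(4) unfolding isomorphic_iff[OF assms(1,2)] by blast
  obtain g where g: "bij_betw g (pverts Y) (pverts Z)"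
    and F: "\<And>u v. u \<in> pverts Y \<Longrightarrow> v \<in> pverts Y \<Longrightarrow> (u, v) \<in> parcs Y \<longleftrightarrow> (g u, g v) \<in> parcs Z"
    using assms(5) unfolding isomorphic_iff[OF assms(2,3)] by blast
  have "bij_betw (g \<circ> f) (pverts X) (pverts Z)" using f g by (rule bij_betw_trans)
  moreover have "(u, v) \<in> parcs X \<longleftrightarrow> ((g \<circ> f) u, (g \<circ> f) v) \<in> parcs Z"
    if "u \<in> pverts X" "v \<in> pverts X" for u v
  proof -
    have "f u \<in> pverts Y" "f v \<in> pverts Y" using f that bij_betwE by blast+
    then show ?thesis using E[OF that] F[of "f u" "f v"] by simp
  qed
  ultimately show ?thesis unfolding isomorphic_iff[OF assms(1,3)] by blast
qed

lemma iso_class_eq_iff: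
  assumes "pair_wf_digraph X" "pair_wf_digraph Y"
  shows "iso_class X = iso_class Y \<longleftrightarrow> isomorphic X Y"
proof
  assume "iso_class X = iso_class Y"
  moreover have "Y \<in> iso_class Y" using assms isomorphic_refl by (simp add: iso_class_def)
  ultimately show "isomorphic X Y" by (auto simp: iso_class_def)
next
  assume "isomorphic X Y"
  then show "iso_class X = iso_class Y"
    unfolding iso_class_def using assms isomorphic_sym isomorphic_trans by blast
qed

lemma card_image_eq_of_same_kernel:
  assumes "finite A" and eq: "\<And>x y. x \<in> A \<Longrightarrow> y \<in> A \<Longrightarrow> f x = f y \<longleftrightarrow> g x = g y"
  shows "card (f ` A) = card (g ` A)"
proof -
  have le: "card (g ` A) \<le> card (f ` A)"
    if eq: "\<And>x y. x \<in> A \<Longrightarrow> y \<in> A \<Longrightarrow> f x = f y \<Longrightarrow> g x = g y" for f :: "'a \<Rightarrow> 'd" and g :: "'a \<Rightarrow> 'e"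
  proof -
    have "g x = g (SOME y. y \<in> A \<and> f y = f x)" if "x \<in> A" for x
      using someI[of "\<lambda>y. y \<in> A \<and> f y = f x" x] that eq by metis
    then have "g ` A = (\<lambda>c. g (SOME y. y \<in> A \<and> f y = c)) ` f ` A"
      unfolding image_image by (rule image_cong[OF refl])
    then show ?thesis using card_image_le[of "f ` A"] assms(1) by simp
  qed
  show ?thesis by (rule antisym; rule le) (use eq in blast)+
qed

lemma num_iso_classes_eq:
  fixes A :: "int pair_pre_digraph set"
  assumes fin: "finite A" and wf: "\<And>X. X \<in> A \<Longrightarrow> pair_wf_digraph X"
  shows "num_iso_classes A = card (iso_class ` A)"
proof -
  let ?R = "{(X, Y). X \<in> A \<and> Y \<in> A \<and> isomorphic X Y}"
  have "A // ?R = (\<lambda>X. {Y \<in> A. isomorphic X Y}) ` A"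
    by (auto simp: quotient_def)
  moreover have "card ((\<lambda>X. {Y \<in> A. isomorphic X Y}) ` A) = card (iso_class ` A)"
  proof (rule card_image_eq_of_same_kernel[OF fin])
    fix X Y assume XY: "X \<in> A" "Y \<in> A"
    show "{Z \<in> A. isomorphic X Z} = {Z \<in> A. isomorphic Y Z} \<longleftrightarrow> iso_class X = iso_class Y"
    proof
      assume "{Z \<in> A. isomorphic X Z} = {Z \<in> A. isomorphic Y Z}"
      moreover have "Y \<in> {Z \<in> A. isomorphic Y Z}" using XY wf isomorphic_refl by blast
      ultimately have "isomorphic X Y" by blast
      then show "iso_class X = iso_class Y" using iso_class_eq_iff XY wf by blast
    next
      assume "iso_class X = iso_class Y"
      then have "isomorphic X Z \<longleftrightarrow> isomorphic Y Z" if "Z \<in> A" for Z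
        using that wf unfolding iso_class_def by blast
      then show "{Z \<in> A. isomorphic X Z} = {Z \<in> A. isomorphic Y Z}" by blast
    qed
  qed
  ultimately show ?thesis by (simp add: num_iso_classes_def)
qed

lemma num_iso_classes_Un:
  fixes A B :: "int pair_pre_digraph set"
  assumes fin: "finite A" "finite B" and wf: "\<And>X. X \<in> A \<union> B \<Longrightarrow> pair_wf_digraph X"
    and sep: "\<And>X Y. X \<in> A \<Longrightarrow> Y \<in> B \<Longrightarrow> \<not> isomorphic X Y"
  shows "num_iso_classes (A \<union> B) = num_iso_classes A + num_iso_classes B"
proof -
  have "iso_class ` A \<inter> iso_class ` B = {}"
    using sep wf iso_class_eq_iff by blast
  then show ?thesis
    using fin wf num_iso_classes_eq[of "A \<union> B"] num_iso_classes_eq[of A] num_iso_classes_eq[of B]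
    by (simp add: image_Un card_Un_disjoint)
qed

lemma circulant_wf: "circulant n X \<Longrightarrow> pair_wf_digraph X"
  unfolding circulant_def by (intro pair_digraph.pair_wf_digraph) blast

lemma finite_circulants:
  assumes n: "n > 0"
  shows "finite {X. circulant n X}"
proof -
  have "{X. circulant n X} = circ n ` Pow {1..<int n}"
    using circulant_iff_circ[OF n] by blast
  then show ?thesis by simp
qed

lemma undirected_isomorphic:
  assumes wf: "pair_wf_digraph X" "pair_wf_digraph Y" and iso: "isomorphic X Y" and Y: "undirected Y"
  shows "undirected X"
proof -
  obtain f where E: "\<And>u v. u \<in> pverts X \<Longrightarrow> v \<in> pverts X \<Longrightarrow> (u, v) \<in> parcs X \<longleftrightarrow> (f u, f v) \<in> parcs Y"
    using iso unfolding isomorphic_iff[OF wf] by blast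
  have "(v, u) \<in> parcs X" if "(u, v) \<in> parcs X" for u v
    using pair_wf_digraph.wellformed'[OF wf(1) that] that E Y
    by (auto simp: undirected_def symmetric_def sym_def)
  then show ?thesis by (auto simp: undirected_def symmetric_def sym_def)
qed

lemma tournament_isomorphic:
  assumes wf: "pair_wf_digraph X" "pair_wf_digraph Y" and iso: "isomorphic X Y" and Y: "tournament Y"
  shows "tournament X"
proof -
  obtain f where f: "bij_betw f (pverts X) (pverts Y)"
    and E: "\<And>u v. u \<in> pverts X \<Longrightarrow> v \<in> pverts X \<Longrightarrow> (u, v) \<in> parcs X \<longleftrightarrow> (f u, f v) \<in> parcs Y"
    using iso unfolding isomorphic_iff[OF wf] by blast
  show ?thesis
    unfolding tournament_def
  proof (intro ballI impI)
    fix u v assume uv: "u \<in> pverts X" "v \<in> pverts X" "u \<noteq> v"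
    then have "f u \<in> pverts Y" "f v \<in> pverts Y" "f u \<noteq> f v"
      using f by (auto simp: bij_betw_def dest: inj_onD)
    then show "((u, v) \<in> parcs X) \<noteq> ((v, u) \<in> parcs X)"
      using Y uv E unfolding tournament_def by blast
  qed
qed

lemma su_t_circulants_not_isomorphic:
  assumes n: "n > 1" and X: "X \<in> su_circulants n" and Y: "Y \<in> t_circulants n"
  shows "\<not> isomorphic X Y"
proof
  assume "isomorphic X Y"
  then have "tournament X"
    using X Y tournament_isomorphic circulant_wf by (auto simp: su_circulants_def t_circulants_def)
  moreover obtain S where "S \<subseteq> {1..<int n}" "X = circ n S"
    using X n circulant_iff_circ[of n] by (auto simp: su_circulants_def)
  ultimately show False using not_undirected_and_tournament[OF n] X by (auto simp: su_circulants_def)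
qed

lemma num_iso_classes_sd_split:
  assumes n: "n > 1"
  shows "num_iso_classes {X \<in> sd_circulants n. P X} = num_iso_classes {X \<in> su_circulants n. P X}
    + num_iso_classes {X \<in> t_circulants n. P X} + num_iso_classes {X \<in> mixed_sd_circulants n. P X}"
proof -
  let ?M = "{X \<in> mixed_sd_circulants n. P X}" and ?U = "{X \<in> su_circulants n. P X}" and ?T = "{X \<in> t_circulants n. P X}"
  have n0: "n > 0" using n by simp
  have split: "{X \<in> sd_circulants n. P X} = (?U \<union> ?T) \<union> ?M"
    using t_circulants_self_complementary[OF n0]
    by (auto simp: mixed_sd_circulants_def sd_circulants_def su_circulants_def t_circulants_def)
  have circ: "circulant n X" if "X \<in> ?U \<union> ?T \<union> ?M" for X
    using that by (auto simp: mixed_sd_circulants_def sd_circulants_def su_circulants_def t_circulants_def)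
  have fin: "finite ?U" "finite ?T" "finite ?M"
    by (rule finite_subset[OF _ finite_circulants[OF n0]], use circ in blast)+
  have sep: "\<not> isomorphic X Y" if X: "X \<in> ?U \<union> ?T" and Y: "Y \<in> ?M" for X Y
  proof
    assume iso: "isomorphic X Y"
    have wf: "pair_wf_digraph X" "pair_wf_digraph Y" using X Y circ circulant_wf by blast+
    have "isomorphic Y X" using isomorphic_sym[OF wf iso] .
    moreover have "undirected X \<or> tournament X" using X by (auto simp: su_circulants_def t_circulants_def)
    ultimately have "undirected Y \<or> tournament Y"
      using undirected_isomorphic[OF wf(2,1)] tournament_isomorphic[OF wf(2,1)] by blast
    then show False using Y by (auto simp: mixed_sd_circulants_def)
  qed
  have "num_iso_classes {X \<in> sd_circulants n. P X} = num_iso_classes (?U \<union> ?T) + num_iso_classes ?M"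
    unfolding split by (rule num_iso_classes_Un) (use fin circ circulant_wf sep in blast)+
  also have "num_iso_classes (?U \<union> ?T) = num_iso_classes ?U + num_iso_classes ?T"
  proof (rule num_iso_classes_Un[OF fin(1,2)])
    show "pair_wf_digraph X" if "X \<in> ?U \<union> ?T" for X using that circ circulant_wf by blast
    show "\<not> isomorphic X Y" if "X \<in> ?U" "Y \<in> ?T" for X Y
      using that su_t_circulants_not_isomorphic[OF n] by blast
  qed
  finally show ?thesis .
qed

text \<open>
The wreath product on digraphs instead of connection sets, so that it can be counted as an image.
\<close>

definition wreath_digraph :: "nat \<Rightarrow> int pair_pre_digraph \<times> int pair_pre_digraph \<Rightarrow> int pair_pre_digraph" where
  "wreath_digraph p XY = circ (p\<^sup>2) (wreath p {s \<in> {1..<int p}. (0, s) \<in> parcs (fst XY)}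
     {s \<in> {1..<int p}. (0, s) \<in> parcs (snd XY)})"

lemma wreath_digraph_circ:
  assumes p: "p > 0" and A: "A \<subseteq> {1..<int p}" and B: "B \<subseteq> {1..<int p}"
  shows "wreath_digraph p (circ p A, circ p B) = circ (p\<^sup>2) (wreath p A B)"
proof -
  have "{s \<in> {1..<int p}. (0, s) \<in> parcs (circ p S)} = S" if "S \<subseteq> {1..<int p}" for S
    using that p by (auto simp: subset_iff)
  then show ?thesis using A B by (simp add: wreath_digraph_def)
qed

lemma isomorphic_wreath_digraph_iff:
  assumes p: "prime p" "odd p"
    and circ: "circulant p X" "circulant p Y" "circulant p X'" "circulant p Y'"
  shows "isomorphic (wreath_digraph p (X, Y)) (wreath_digraph p (X', Y')) \<longleftrightarrow> isomorphic X X' \<and> isomorphic Y Y'"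
proof -
  have p0: "p > 0" using p by (simp add: prime_gt_0_nat)
  obtain A where A: "A \<subseteq> {1..<int p}" "X = circ p A" using circ circulant_iff_circ[OF p0] by blast
  obtain B where B: "B \<subseteq> {1..<int p}" "Y = circ p B" using circ circulant_iff_circ[OF p0] by blast
  obtain A' where A': "A' \<subseteq> {1..<int p}" "X' = circ p A'" using circ circulant_iff_circ[OF p0] by blast
  obtain B' where B': "B' \<subseteq> {1..<int p}" "Y' = circ p B'" using circ circulant_iff_circ[OF p0] by blast
  show ?thesis
    unfolding A(2) B(2) A'(2) B'(2) wreath_digraph_circ[OF p0 A(1) B(1)] wreath_digraph_circ[OF p0 A'(1) B'(1)]
    using isomorphic_wreath[OF p0 A(1) B(1) A'(1) B'(1)]
      isomorphic_wreath_imp_mult_equiv[OF p A(1) B(1) A'(1) B'(1)] mult_equiv_imp_isomorphic[OF p0] by blast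
qed

text \<open>
Undirected outer and tournament inner factor, or the other way round: the two families do not
overlap up to isomorphism, and the classes in each correspond to pairs of classes of the factors.
\<close>

lemma num_iso_classes_mixed:
  assumes p: "prime p" "odd p"
  shows "num_iso_classes (mixed_sd_circulants (p\<^sup>2)) = 2 * C_su p * C_t p"
proof -
  let ?U = "su_circulants p" and ?T = "t_circulants p" and ?w = "wreath_digraph p"
  have p0: "p > 0" "p > 1" "p\<^sup>2 > 0" using p prime_gt_1_nat by (auto simp: prime_gt_0_nat)
  have circ: "circulant p X" if "X \<in> ?U \<union> ?T" for X
    using that by (auto simp: su_circulants_def t_circulants_def)
  have fin: "finite ?U" "finite ?T"
    by (rule finite_subset[OF _ finite_circulants[OF p0(1)]], use circ in blast)+
  have mixed: "mixed_sd_circulants (p\<^sup>2) = ?w ` (?U \<times> ?T) \<union> ?w ` (?T \<times> ?U)"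
  proof (rule equalityI; rule subsetI)
    fix Z assume "Z \<in> mixed_sd_circulants (p\<^sup>2)"
    then obtain A B where AB: "A \<subseteq> {1..<int p}" "B \<subseteq> {1..<int p}" "Z = circ (p\<^sup>2) (wreath p A B)"
      "circ p A \<in> ?U \<and> circ p B \<in> ?T \<or> circ p A \<in> ?T \<and> circ p B \<in> ?U"
      by (rule mixed_sd_circulants_wreath[OF p])
    then have "Z = ?w (circ p A, circ p B)" using wreath_digraph_circ[OF p0(1)] by simp
    then show "Z \<in> ?w ` (?U \<times> ?T) \<union> ?w ` (?T \<times> ?U)" using AB(4) by blast
  next
    fix Z assume "Z \<in> ?w ` (?U \<times> ?T) \<union> ?w ` (?T \<times> ?U)"
    then obtain X Y where XY: "Z = ?w (X, Y)" "X \<in> ?U \<and> Y \<in> ?T \<or> X \<in> ?T \<and> Y \<in> ?U" by blast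
    obtain A where A: "A \<subseteq> {1..<int p}" "X = circ p A" using XY circ circulant_iff_circ[OF p0(1)] by blast
    obtain B where B: "B \<subseteq> {1..<int p}" "Y = circ p B" using XY circ circulant_iff_circ[OF p0(1)] by blast
    show "Z \<in> mixed_sd_circulants (p\<^sup>2)"
      using wreath_in_mixed_sd_circulants[OF p0(2) A(1) B(1)] XY wreath_digraph_circ[OF p0(1) A(1) B(1)]
      unfolding A(2) B(2) by simp
  qed
  have wf: "pair_wf_digraph (?w XY)" for XY by (simp add: wreath_digraph_def)
  have count: "num_iso_classes (?w ` (V \<times> W)) = num_iso_classes V * num_iso_classes W"
    if V: "V = ?U \<or> V = ?T" and W: "W = ?U \<or> W = ?T" for V W
  proof -
    have finVW: "finite V" "finite W" using V W fin by blast+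
    have cV: "circulant p X" if "X \<in> V" for X using that V circ by blast
    have cW: "circulant p X" if "X \<in> W" for X using that W circ by blast
    have "num_iso_classes (?w ` (V \<times> W)) = card ((\<lambda>XY. iso_class (?w XY)) ` (V \<times> W))"
      using finVW wf by (subst num_iso_classes_eq) (auto simp: image_image)
    also have "\<dots> = card (map_prod iso_class iso_class ` (V \<times> W))"
    proof (rule card_image_eq_of_same_kernel)
      show "finite (V \<times> W)" using finVW by simp
      fix x y assume xy: "x \<in> V \<times> W" "y \<in> V \<times> W"
      obtain X Y X' Y' where e: "x = (X, Y)" "y = (X', Y')" by (cases x, cases y)
      have c: "circulant p X" "circulant p Y" "circulant p X'" "circulant p Y'"
        using xy cV cW unfolding e by blast+
      show "iso_class (?w x) = iso_class (?w y) \<longleftrightarrow> map_prod iso_class iso_class x = map_prod iso_class iso_class y"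
        unfolding iso_class_eq_iff[OF wf wf] e isomorphic_wreath_digraph_iff[OF p c]
        using iso_class_eq_iff circulant_wf c by simp
    qed
    also have "map_prod iso_class iso_class ` (V \<times> W) = iso_class ` V \<times> iso_class ` W"
      by (rule map_prod_surj_on[OF refl refl])
    finally show ?thesis
      using num_iso_classes_eq[OF finVW(1) circulant_wf[OF cV]] num_iso_classes_eq[OF finVW(2) circulant_wf[OF cW]]
      by (simp add: card_cartesian_product)
  qed
  have "num_iso_classes (mixed_sd_circulants (p\<^sup>2)) = num_iso_classes (?w ` (?U \<times> ?T)) + num_iso_classes (?w ` (?T \<times> ?U))"
    unfolding mixed
  proof (rule num_iso_classes_Un)
    show "\<not> isomorphic Z Z'" if Z: "Z \<in> ?w ` (?U \<times> ?T)" and Z': "Z' \<in> ?w ` (?T \<times> ?U)" for Z Z'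
    proof
      assume iso: "isomorphic Z Z'"
      obtain X Y where XY: "Z = ?w (X, Y)" "X \<in> ?U" "Y \<in> ?T" using Z by blast
      obtain X' Y' where XY': "Z' = ?w (X', Y')" "X' \<in> ?T" "Y' \<in> ?U" using Z' by blast
      have "isomorphic X X'"
        using iso isomorphic_wreath_digraph_iff[OF p, of X Y X' Y'] circ XY XY' by blast
      then show False using su_t_circulants_not_isomorphic[OF p0(2) XY(2) XY'(2)] by blast
    qed
  qed (use fin wf in auto)
  then show ?thesis using count[of ?U ?T] count[of ?T ?U] by (simp add: C_su_def C_t_def)
qed

theorem mainTheorem6:
  fixes p :: nat
  assumes "prime p" and "odd p"
  shows "C_sd_mixed (p\<^sup>2) = 2 * int (C_su p) * int (C_t p) \<and>
         C_sd_mixed (p\<^sup>2) = int (D_sd (p\<^sup>2)) - int (D_su (p\<^sup>2)) - int (D_t (p\<^sup>2)) \<and>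
         (\<forall>X \<in> mixed_sd_circulants (p\<^sup>2). non_CI (p\<^sup>2) X)"
proof -
  have n: "p\<^sup>2 > 1" by (rule one_less_power[OF prime_gt_1_nat[OF assms(1)]]) simp
  have CI: "\<forall>X \<in> mixed_sd_circulants (p\<^sup>2). non_CI (p\<^sup>2) X"
    using mixed_sd_circulant_non_CI[OF assms, of _ 2] by simp
  then have M: "{X \<in> mixed_sd_circulants (p\<^sup>2). non_CI (p\<^sup>2) X} = mixed_sd_circulants (p\<^sup>2)" by blast
  have C: "C_sd_mixed (p\<^sup>2) = int (num_iso_classes (mixed_sd_circulants (p\<^sup>2)))"
    using num_iso_classes_sd_split[OF n, of "\<lambda>_. True"] by (simp add: C_sd_mixed_def C_sd_def C_su_def C_t_def)
  have D: "int (D_sd (p\<^sup>2)) - int (D_su (p\<^sup>2)) - int (D_t (p\<^sup>2)) = int (num_iso_classes (mixed_sd_circulants (p\<^sup>2)))"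
    using num_iso_classes_sd_split[OF n, of "non_CI (p\<^sup>2)"] by (simp add: D_sd_def D_su_def D_t_def M)
  show ?thesis using C D CI num_iso_classes_mixed[OF assms] by simp
qed

end
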